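(* For any real $k > 0$, Ramanujan's $\varphi$-function satisfies $$\varphi\left(e^{-k\pi}\right) = 1 + \int_0^{\infty} \frac{e^{-t^2/2}}{\sqrt{2\pi}} \left[ \frac{4 e^{k\pi} \left(e^{2k\pi} - \cos\left(\sqrt{2\pi k}\, t\right)\right)}{e^{4k\pi} - 2 e^{2k\pi} \cos\left(\sqrt{2\pi k}\, t\right) + 1} \right] dt.$$ Moreover, the special values of this function at $k \in \{1,2,3,5\}$ have the respective integral representations $$\frac{\pi^{1/4}}{\Gamma\left(\frac{3}{4}\right)} = 1 + \int_0^{\infty} \frac{e^{-t^2/2}}{\sqrt{2\pi}} \left[ \frac{4 e^{\pi} \left(e^{2\pi} - \cos\left(\sqrt{2\pi}\, t\right)\right)}{e^{4\pi} - 2 e^{2\pi} \cos\left(\sqrt{2\pi}\, t\right) + 1} \right] dt,$$ $$\frac{\pi^{1/4}}{\Gamma\left(\frac{3}{4}\right)} \cdot \frac{\sqrt{\sqrt{2} + 2}}{2} = 1 + \int_0^{\infty} \frac{e^{-t^2/2}}{\sqrt{2\pi}} \left[ \frac{4 e^{2\pi} \left(e^{4\pi} - \cos\left(2 \sqrt{\pi}\, t\right)\right)}{e^{8\pi} - 2 e^{4\pi} \cos\left(2 \sqrt{\pi}\, t\right) + 1} \right] dt,$$ $$\frac{\pi^{1/4}}{\Gamma\left(\frac{3}{4}\right)} \cdot \frac{\sqrt{\sqrt{3} + 1}}{2^{1/4} 3^{3/8}} = 1 + \int_0^{\infty} \frac{e^{-t^2/2}}{\sqrt{2\pi}} \left[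 \frac{4 e^{3\pi} \left(e^{6\pi} - \cos\left(\sqrt{6 \pi}\, t\right)\right)}{e^{12\pi} - 2 e^{6\pi} \cos\left(\sqrt{6 \pi}\, t\right) + 1} \right] dt,$$ $$\frac{\pi^{1/4}}{\Gamma\left(\frac{3}{4}\right)} \cdot \frac{\sqrt{5 + 2 \sqrt{5}}}{5^{3/4}} = 1 + \int_0^{\infty} \frac{e^{-t^2/2}}{\sqrt{2\pi}} \left[ \frac{4 e^{5\pi} \left(e^{10\pi} - \cos\left(\sqrt{10 \pi}\, t\right)\right)}{e^{20\pi} - 2 e^{10\pi} \cos\left(\sqrt{10 \pi}\, t\right) + 1} \right] dt.$$
   Context: Ramanujan's $\varphi$-function is $\varphi(q) := \sum_{n=-\infty}^{\infty} q^{n^2} = 1 + 2\sum_{n=1}^{\infty} q^{n^2}$ for $|q| < 1$; it equals the Jacobi theta function $\vartheta_3(q) = \vartheta_3(0,q)$. $\Gamma$ is the gamma function. *)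

theory Defs
  imports "HOL-Analysis.Analysis"
begin

definition ramanujan_phi :: "'a :: {real_normed_field, banach} \<Rightarrow> 'a" where
  "ramanujan_phi q = (\<Sum>\<^sub>\<infinity>n::int. q powi (n\<^sup>2))"

lemma has_sum_ramanujan_phi:
  fixes q :: "'a :: {real_normed_field, banach}"
  assumes "norm q < 1"
  shows "((\<lambda>n::int. q powi (n\<^sup>2)) has_sum (1 + 2 * (\<Sum>n. q ^ ((Suc n)\<^sup>2)))) UNIV"
proof -
  let ?g = "\<lambda>n. q ^ ((Suc n)\<^sup>2)" and ?f = "\<lambda>n::int. q powi (n\<^sup>2)"
  have s: "summable (\<lambda>n. norm (?g n))"
  proof (rule summable_comparison_test')
    show "summable (\<lambda>n. norm q ^ n)" using assms by (simp add: summable_geometric)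
    fix n :: nat
    have "n \<le> (Suc n)\<^sup>2" by (simp add: power2_eq_square)
    then show "norm (norm (?g n)) \<le> norm q ^ n"
      using assms power_decreasing[of n "(Suc n)\<^sup>2" "norm q"] by (simp add: norm_power)
  qed
  have g: "(?g has_sum suminf ?g) UNIV"
    by (rule norm_summable_imp_has_sum[OF s summable_sums[OF summable_norm_cancel[OF s]]])
  have f: "?f (int (Suc n)) = ?g n" "?f (- int (Suc n)) = ?g n" for n
    by (simp_all only: power2_minus of_nat_power[symmetric] power_int_of_nat)
  have p: "(?f has_sum suminf ?g) ((\<lambda>n. int (Suc n)) ` UNIV)"
    by (subst has_sum_reindex) (simp add: inj_on_def, simp only: o_def f g)
  have m: "(?f has_sum suminf ?g) ((\<lambda>n. - int (Suc n)) ` UNIV)"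
    by (subst has_sum_reindex) (simp add: inj_on_def, simp only: o_def f g)
  have z: "(?f has_sum 1) {0}" using has_sum_finite[of "{0::int}" ?f] by simp
  have u: "UNIV = {0::int} \<union> ((\<lambda>n. int (Suc n)) ` UNIV \<union> (\<lambda>n. - int (Suc n)) ` UNIV)"
  proof -
    have "x \<in> {0::int} \<union> ((\<lambda>n. int (Suc n)) ` UNIV \<union> (\<lambda>n. - int (Suc n)) ` UNIV)" for x
    proof (cases "x = 0")
      case False
      then have "x = int (Suc (nat (x - 1))) \<or> x = - int (Suc (nat (- x - 1)))" by auto
      then show ?thesis by blast
    qed auto
    then show ?thesis by blast
  qed
  have "(?f has_sum (1 + (suminf ?g + suminf ?g)))
          ({0::int} \<union> ((\<lambda>n. int (Suc n)) ` UNIV \<union> (\<lambda>n. - int (Suc n)) ` UNIV))"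
    by (intro has_sum_Un_disjoint z p m) auto
  then show ?thesis by (simp only: u[symmetric] mult_2)
qed

corollary ramanujan_phi_eq:
  fixes q :: "'a :: {real_normed_field, banach}"
  assumes "norm q < 1"
  shows "ramanujan_phi q = 1 + 2 * (\<Sum>n. q ^ ((Suc n)\<^sup>2))"
  unfolding ramanujan_phi_def using has_sum_ramanujan_phi[OF assms] by (rule infsumI)

end

theory Submission
  imports Defs "HOL-Probability.Probability" "HOL-Real_Asymp.Real_Asymp"
    "HOL-Computational_Algebra.Fundamental_Theorem_Algebra"
begin

text \<open>
  The integral formula is a termwise integration. With \<open>x = exp (-2 k \<pi>)\<close> and
  \<open>\<theta> = sqrt (2 \<pi> k) t\<close> the bracket is \<open>4 exp (-k \<pi>)\<close> times the geometric cosine series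
  \<open>\<Sum>n. x ^ n cos (n \<theta>)\<close>, and the integral of \<open>cos (s t)\<close> against the normal density over the line is
  \<open>exp (-s^2/2)\<close>. The \<open>n\<close>-th term therefore contributes \<open>2 exp (-k \<pi> (n+1)^2)\<close> on the half line, which
  is the \<open>n\<close>-th term of \<open>\<phi> (exp (-k \<pi>)) - 1\<close> (\<open>phi_integral_representation\<close>).

  The special values come from Gauss's arithmetic-geometric mean. Put \<open>a = \<phi>(q)^2\<close>,
  \<open>b = \<phi>(-q)^2\<close>, \<open>c = sqrt (a^2 - b^2)\<close>. Replacing \<open>q\<close> by \<open>q^2\<close> turns \<open>(a, b)\<close> into
  \<open>((a + b)/2, sqrt (a b))\<close> and \<open>c\<close> into \<open>(a - b)/2\<close> (\<open>phi_agm_step\<close>), and the integral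
  \<open>I(a, b)\<close> of \<open>1 / sqrt ((x^2 + a^2)(x^2 + b^2))\<close> over the line does not change under this step.
  Since \<open>a\<close> and \<open>b\<close> tend to 1 along \<open>q, q^2, q^4, ...\<close>, it follows that \<open>I(a, b) = \<pi>\<close>
  (\<open>agm_phi_ab\<close>). The pair \<open>(a, c)\<close> runs through the same step backwards, each time gaining a factor 2,
  and the logarithmic growth of \<open>I(1, c)\<close> as \<open>c \<rightarrow> 0\<close> gives \<open>I(a, c) = ln (1/q)\<close> (\<open>agm_phi_ac\<close>).

  At \<open>q = exp (-\<pi>)\<close> both integrals equal \<open>\<pi>\<close>, so \<open>b = c = a / sqrt 2\<close> and \<open>a\<close> is a lemniscatic
  integral, that is, a Beta value (\<open>phi_exp_minus_pi\<close>). The same step gives \<open>\<phi> (exp (-2 \<pi>))\<close>. Comparing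
  the two integrals at \<open>exp (-\<pi> t)\<close> and \<open>exp (-\<pi> / t)\<close>, where monotonicity leaves only one
  possibility, gives the inversion formula \<open>\<phi> (exp (-\<pi>/t)) = sqrt t \<phi> (exp (-\<pi> t))\<close>
  (\<open>phi_inversion\<close>) without Poisson summation.

  For \<open>p = 3\<close> and \<open>p = 5\<close>, Gauss's product for \<open>\<phi>\<close> evaluates the product of \<open>\<phi>(z q)\<close> over the
  \<open>p\<close>-th roots of unity \<open>z\<close> (\<open>phi_unity_roots\<close>). Sorting the series of \<open>\<phi>(z q)\<close> by residues mod \<open>p\<close>
  makes this an algebraic relation between \<open>\<phi>(q)\<close>, \<open>\<phi>(q^p)\<close>, \<open>\<phi>(q^(p^2))\<close>; for \<open>p = 5\<close> one more
  relation is needed, and it comes from sorting the Gaussian integers divisible by \<open>2 + i\<close>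
  (\<open>phi_cubic\<close>, \<open>phi_quintic\<close>). At \<open>q = exp (-\<pi>/p)\<close> the first and last of the three values differ by
  the factor \<open>sqrt p\<close>, and one polynomial equation for \<open>\<phi> (exp (-\<pi>)) / \<phi> (exp (-p \<pi>))\<close> remains.
\<close>

section \<open>The arithmetic-geometric mean integral\<close>

definition agm_integrand :: "real \<Rightarrow> real \<Rightarrow> real \<Rightarrow> real" where
  "agm_integrand a b x = 1 / sqrt ((x\<^sup>2 + a\<^sup>2) * (x\<^sup>2 + b\<^sup>2))"

text \<open>
This is \<open>\<pi>\<close> divided by the arithmetic-geometric mean of \<open>a\<close> and \<open>b\<close>. Integrating over the whole line
  rather than the half line saves factors of 2 in the invariance under the step of the mean.
\<close>
definition agm_integral :: "real \<Rightarrow> real \<Rightarrow> real" where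
  "agm_integral a b = (LINT x|lborel. agm_integrand a b x)"

lemma cauchy_density_integral:
  assumes "a > 0"
  shows "integrable lborel (\<lambda>x::real. 1 / (x\<^sup>2 + a\<^sup>2))"
    and "(LINT x::real|lborel. 1 / (x\<^sup>2 + a\<^sup>2)) = pi / a"
proof -
  let ?f = "\<lambda>x::real. 1 / (x\<^sup>2 + a\<^sup>2)" and ?F = "\<lambda>x. arctan (x / a) / a"
  have pos: "x\<^sup>2 + a\<^sup>2 > 0" for x :: real
    using assms by (simp add: add_nonneg_pos)
  have deriv: "DERIV ?F x :> ?f x" for x
  proof -
    have "DERIV ?F x :> (inverse (1 + (x / a)\<^sup>2) * (1 / a)) / a"
      using assms by (auto intro!: derivative_eq_intros)
    moreover have "(inverse (1 + (x / a)\<^sup>2) * (1 / a)) / a = ?f x"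
    proof -
      have "1 + (x / a)\<^sup>2 = (x\<^sup>2 + a\<^sup>2) / a\<^sup>2"
        using assms by (simp add: field_simps)
      then show ?thesis
        using assms by (simp add: power2_eq_square)
    qed
    ultimately show ?thesis by simp
  qed
  have top: "filterlim (\<lambda>x::real. x / a) at_top at_top"
    using assms by real_asymp
  have bot: "filterlim (\<lambda>x::real. x / a) at_bot at_bot"
    using assms by real_asymp
  have "(?F \<longlongrightarrow> (pi / 2) / a) at_top" "(?F \<longlongrightarrow> - (pi / 2) / a) at_bot"
    using filterlim_compose[OF tendsto_arctan_at_top top] filterlim_compose[OF tendsto_arctan_at_bot bot]
      assms by (intro tendsto_divide; simp)+
  then have lim: "((?F \<circ> real_of_ereal) \<longlongrightarrow> - (pi / 2) / a) (at_right (-\<infinity>))"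
      "((?F \<circ> real_of_ereal) \<longlongrightarrow> (pi / 2) / a) (at_left \<infinity>)"
    by (simp_all add: ereal_tendsto_simps)
  have "set_integrable lborel (einterval (-\<infinity>) \<infinity>) ?f"
       "(LBINT x=-\<infinity>..\<infinity>. ?f x) = (pi / 2) / a - (- (pi / 2) / a)"
    by (rule interval_integral_FTC_nonneg[OF _ deriv _ _ lim];
        use pos less_imp_le[OF pos] in \<open>force intro!: continuous_intros simp: less_imp_neq[symmetric]\<close>)+
  then show "integrable lborel ?f" "(LINT x|lborel. ?f x) = pi / a"
    by (simp_all add: set_integrable_def interval_lebesgue_integral_def set_lebesgue_integral_def)
qed

lemma agm_integrand_nonneg [simp]: "agm_integrand a b x \<ge> 0"
  by (simp add: agm_integrand_def)

lemma agm_integrand_measurable [measurable]: "agm_integrand a b \<in> borel_measurable borel"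
  unfolding agm_integrand_def by measurable

lemma agm_integrand_antimono:
  assumes "0 < a" "a \<le> a'" "0 < b" "b \<le> b'"
  shows "agm_integrand a' b' x \<le> agm_integrand a b x"
  unfolding agm_integrand_def using assms
  by (intro divide_left_mono real_sqrt_le_mono mult_mono add_left_mono power_mono mult_pos_pos)
     (auto intro!: mult_pos_pos add_nonneg_pos)

lemma agm_integrand_diag: "a > 0 \<Longrightarrow> agm_integrand a a x = 1 / (x\<^sup>2 + a\<^sup>2)"
  by (simp add: agm_integrand_def flip: power2_eq_square)

lemma agm_integrable:
  assumes "0 < a" "0 < b"
  shows "integrable lborel (agm_integrand a b)"
proof (rule Bochner_Integration.integrable_bound)
  show "integrable lborel (\<lambda>x::real. 1 / (x\<^sup>2 + (min a b)\<^sup>2))"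
    using assms by (intro cauchy_density_integral) simp
  show "AE x in lborel. norm (agm_integrand a b x) \<le> norm (1 / (x\<^sup>2 + (min a b)\<^sup>2))"
    using agm_integrand_antimono[of "min a b" a "min a b" b] agm_integrand_diag[of "min a b"] assms
    by (intro AE_I2) simp
qed simp

lemma agm_integral_antimono:
  assumes "0 < a" "a \<le> a'" "0 < b" "b \<le> b'"
  shows "agm_integral a' b' \<le> agm_integral a b"
  unfolding agm_integral_def using assms
  by (intro integral_mono agm_integrable agm_integrand_antimono) auto

lemma agm_integral_diag: "a > 0 \<Longrightarrow> agm_integral a a = pi / a"
  by (simp add: agm_integral_def agm_integrand_diag cauchy_density_integral)

lemma agm_integral_bounds:
  assumes "0 < m" "m \<le> a" "a \<le> M" "m \<le> b" "b \<le> M"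
  shows "pi / M \<le> agm_integral a b" "agm_integral a b \<le> pi / m"
  using agm_integral_antimono[of a M b M] agm_integral_antimono[of m a m b]
    agm_integral_diag[of m] agm_integral_diag[of M] assms by auto

lemma agm_integral_strict_antimono:
  assumes "0 < a" "0 < b" "b < b'"
  shows "agm_integral a b' < agm_integral a b"
proof -
  have less: "agm_integrand a b' x < agm_integrand a b x" for x
    unfolding agm_integrand_def using assms
    by (intro divide_strict_left_mono real_sqrt_less_mono mult_strict_left_mono add_strict_left_mono
          power_strict_mono mult_pos_pos) (auto intro!: mult_pos_pos add_nonneg_pos)
  have int: "integrable lborel (agm_integrand a b)" "integrable lborel (agm_integrand a b')"
    using assms by (auto intro: agm_integrable)
  have "agm_integral a b' \<noteq> agm_integral a b"
  proof
    assume "agm_integral a b' = agm_integral a b"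
    then have "(LINT x|lborel. agm_integrand a b x - agm_integrand a b' x) = 0"
      using int by (simp add: agm_integral_def)
    then have "AE x in lborel. agm_integrand a b x - agm_integrand a b' x = 0"
      using integral_nonneg_eq_0_iff_AE[of lborel "\<lambda>x. agm_integrand a b x - agm_integrand a b' x"]
        int less_imp_le[OF less] by simp
    then have "AE x in (lborel :: real measure). False"
      by eventually_elim (use less in \<open>simp add: order_less_imp_not_eq2\<close>)
    then show False
      by (simp add: ae_filter_eq_bot_iff flip: trivial_limit_def)
  qed
  then show ?thesis
    using agm_integral_antimono[of a a b b'] assms by simp
qed

lemma agm_integral_commute: "agm_integral a b = agm_integral b a"
  by (simp add: agm_integral_def agm_integrand_def mult.commute)

lemma agm_integral_scale:
  assumes "r > 0"
  shows "agm_integral (r * a) (r * b) = agm_integral a b / r"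
proof -
  have *: "agm_integrand (r * a) (r * b) (r * x) = agm_integrand a b x / r\<^sup>2" for x
  proof -
    have "((r * x)\<^sup>2 + (r * a)\<^sup>2) * ((r * x)\<^sup>2 + (r * b)\<^sup>2) = (r\<^sup>2)\<^sup>2 * ((x\<^sup>2 + a\<^sup>2) * (x\<^sup>2 + b\<^sup>2))"
      by (simp add: algebra_simps power2_eq_square)
    then show ?thesis
      unfolding agm_integrand_def by (simp only: real_sqrt_mult real_sqrt_abs) (simp add: mult.commute)
  qed
  have "agm_integral (r * a) (r * b) = r * (LINT x|lborel. agm_integrand (r * a) (r * b) (0 + r * x))"
    unfolding agm_integral_def using assms by (subst lborel_integral_real_affine[of r _ 0]) auto
  then show ?thesis
    using assms by (simp add: * agm_integral_def power2_eq_square)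
qed

lemma even_integral_halves:
  fixes f :: "real \<Rightarrow> real"
  assumes int: "integrable lborel f" and even: "\<And>x. f (- x) = f x"
  shows "(LINT x|lborel. f x) = 2 * (LBINT x:{0..}. f x)"
    and "(LINT x|lborel. f x) = 2 * (LBINT x=0..\<infinity>. f x)"
proof -
  have si: "set_integrable lborel A f" if "A \<in> sets lborel" for A
    using integrable_mult_indicator[OF that int] by (simp add: set_integrable_def)
  have "(LINT x|lborel. f x) = (LBINT x:{..<0} \<union> {0..}. f x)"
  proof -
    have "{..<0} \<union> {0..} = (UNIV :: real set)" by auto
    then show ?thesis by (simp add: set_lebesgue_integral_def)
  qed
  also have "\<dots> = (LBINT x:{..<0}. f x) + (LBINT x:{0..}. f x)"
    by (intro set_integral_Un si) auto
  also have "(LBINT x:{..<0}. f x) = (LBINT x:{x. - x \<in> {..<0}}. f (- x))"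
    by (rule set_integral_reflect)
  also have "\<dots> = (LBINT x:{0..}. f x)"
    unfolding set_lebesgue_integral_def
    by (intro integral_cong_AE)
       (use int AE_lborel_singleton[of 0] in \<open>auto simp: even indicator_def elim!: eventually_mono intro!: borel_measurable_integrable[OF int] borel_measurable_times\<close>)
  finally show half: "(LINT x|lborel. f x) = 2 * (LBINT x:{0..}. f x)" by simp
  have "(LBINT x=0..\<infinity>. f x) = (LBINT x:{0..}. f x)"
    unfolding interval_lebesgue_integral_0_infty set_lebesgue_integral_def
    by (intro integral_cong_AE)
       (use int AE_lborel_singleton[of 0] in \<open>auto simp: indicator_def elim!: eventually_mono intro!: borel_measurable_integrable[OF int] borel_measurable_times\<close>)
  with half show "(LINT x|lborel. f x) = 2 * (LBINT x=0..\<infinity>. f x)" by simp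
qed

lemma agm_integral_halves:
  assumes "0 < a" "0 < b"
  shows "agm_integral a b = 2 * (LBINT x=0..\<infinity>. agm_integrand a b x)"
  unfolding agm_integral_def using assms
  by (intro even_integral_halves(2) agm_integrable) (auto simp: agm_integrand_def)

text \<open>
Gauss's invariance. The substitution \<open>u = (x - a b / x) / 2\<close> maps the positive half line onto the whole
  line; it gives \<open>u^2 + ((a+b)/2)^2 = (x^2+a^2)(x^2+b^2) / (2x)^2\<close> and
  \<open>u^2 + a b = ((x^2 + a b) / (2x))^2\<close>, and the second square cancels against \<open>du/dx\<close>.
\<close>
lemma agm_integral_step:
  assumes a: "0 < a" and b: "0 < b"
  shows "agm_integral ((a + b) / 2) (sqrt (a * b)) = agm_integral a b"
proof -
  let ?f = "agm_integrand ((a + b) / 2) (sqrt (a * b))"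
  let ?g = "\<lambda>x::real. (x - a * b / x) / 2" and ?g' = "\<lambda>x::real. (1 + a * b / x\<^sup>2) / 2"
  have ab: "a * b > 0" using assms by simp
  have subst_eq: "?f (?g x) * ?g' x = 2 * agm_integrand a b x" if x: "x > 0" for x
  proof -
    let ?P = "(x\<^sup>2 + a\<^sup>2) * (x\<^sup>2 + b\<^sup>2)" and ?Q = "x\<^sup>2 + a * b"
    have P: "?P > 0" and Q: "?Q > 0"
      using x ab by (auto intro!: mult_pos_pos add_pos_nonneg)
    have "(?g x)\<^sup>2 + ((a + b) / 2)\<^sup>2 = ?P / (2 * x)\<^sup>2" "(?g x)\<^sup>2 + a * b = ?Q\<^sup>2 / (2 * x)\<^sup>2"
      using x by (simp_all add: field_simps power2_eq_square)
    then have "((?g x)\<^sup>2 + ((a + b) / 2)\<^sup>2) * ((?g x)\<^sup>2 + (sqrt (a * b))\<^sup>2)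
        = ?P * (?Q / (2 * x)\<^sup>2)\<^sup>2"
      using ab by (simp add: power2_eq_square)
    then have "sqrt (((?g x)\<^sup>2 + ((a + b) / 2)\<^sup>2) * ((?g x)\<^sup>2 + (sqrt (a * b))\<^sup>2))
        = sqrt ?P * (?Q / (2 * x)\<^sup>2)"
      using Q x by (simp only: real_sqrt_mult real_sqrt_abs) simp
    then have "?f (?g x) = (2 * x)\<^sup>2 / (sqrt ?P * ?Q)"
      unfolding agm_integrand_def using x by simp
    moreover have "?g' x = ?Q / (2 * x\<^sup>2)"
      using x by (simp add: field_simps)
    ultimately have "?f (?g x) * ?g' x = (2 * x)\<^sup>2 / (sqrt ?P * ?Q) * (?Q / (2 * x\<^sup>2))"
      by (simp only:)
    also have "\<dots> = 2 / sqrt ?P"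
      using x Q by (simp add: power_mult_distrib del: real_sqrt_mult)
    finally show ?thesis
      by (simp add: agm_integrand_def)
  qed
  have lims: "((ereal \<circ> ?g \<circ> real_of_ereal) \<longlongrightarrow> -\<infinity>) (at_right 0)"
      "((ereal \<circ> ?g \<circ> real_of_ereal) \<longlongrightarrow> \<infinity>) (at_left \<infinity>)"
  proof -
    have "filterlim ?g at_bot (at_right 0)" "filterlim ?g at_top at_top"
      using ab by real_asymp+
    then show "((ereal \<circ> ?g \<circ> real_of_ereal) \<longlongrightarrow> -\<infinity>) (at_right 0)"
      "((ereal \<circ> ?g \<circ> real_of_ereal) \<longlongrightarrow> \<infinity>) (at_left \<infinity>)"
      by (simp_all add: zero_ereal_def ereal_tendsto_simps)
  qed
  have int: "set_integrable lborel (einterval 0 \<infinity>) (\<lambda>x. ?f (?g x) * ?g' x)"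
  proof -
    have "set_integrable lborel (einterval 0 \<infinity>) (\<lambda>x. 2 * agm_integrand a b x)"
      unfolding set_integrable_def using assms
      by (intro integrable_mult_indicator integrable_mult_right agm_integrable) auto
    then show ?thesis
      by (rule set_integrable_cong[THEN iffD2, rotated -1])
         (simp_all only: einterval_iff subst_eq zero_ereal_def less_ereal.simps)
  qed
  have cont: "isCont ?f y" for y
  proof -
    have "sqrt ((y\<^sup>2 + ((a + b) / 2)\<^sup>2) * (y\<^sup>2 + (sqrt (a * b))\<^sup>2)) \<noteq> 0"
      using assms ab by (simp add: add_nonneg_eq_0_iff)
    then show ?thesis
      unfolding agm_integrand_def by (intro continuous_intros) auto
  qed
  have "(LBINT u=-\<infinity>..\<infinity>. ?f u) = (LBINT x=0..\<infinity>. ?f (?g x) * ?g' x)"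
  proof (rule interval_integral_substitution_nonneg(2)[OF _ _ _ _ _ _ lims int])
    show "DERIV ?g x :> ?g' x" if "0 < ereal x" for x
      using that by (auto intro!: derivative_eq_intros simp: power2_eq_square)
    show "isCont ?g' x" if "0 < ereal x" for x
      using that by (auto intro!: continuous_intros)
  qed (use ab cont in auto)
  also have "\<dots> = (LBINT x=0..\<infinity>. 2 * agm_integrand a b x)"
    by (intro interval_integral_cong subst_eq) (simp add: einterval_iff)
  also have "\<dots> = agm_integral a b"
    using assms by (simp add: agm_integral_halves)
  finally show ?thesis
    by (simp add: agm_integral_def interval_lebesgue_integral_def set_lebesgue_integral_def)
qed

text \<open>
For small \<open>c\<close> the integrand is compared with \<open>1 / sqrt (x^2 + c^2) - 1 / sqrt (x^2 + 1)\<close>, which has the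
  primitive \<open>arsinh (x/c) - arsinh x\<close> with limits \<open>\<plusminus> ln (1/c)\<close> at infinity. The error is between 0 and
  \<open>2 / (x^2 + 1)\<close>, uniformly in \<open>c\<close>.
\<close>
lemma agm_integral_log_bounds:
  assumes c: "0 < c" "c \<le> 1"
  shows "2 * ln (1 / c) \<le> agm_integral 1 c" "agm_integral 1 c \<le> 2 * ln (1 / c) + 2 * pi"
proof -
  let ?D = "\<lambda>x::real. 1 / sqrt (x\<^sup>2 + c\<^sup>2) - 1 / sqrt (x\<^sup>2 + 1)"
  let ?F = "\<lambda>x::real. arsinh (x / c) - arsinh x"
  have pos: "x\<^sup>2 + c\<^sup>2 > 0" "x\<^sup>2 + 1 > 0" for x :: real
    using c by (auto intro!: add_nonneg_pos)
  have le: "sqrt (x\<^sup>2 + c\<^sup>2) \<le> sqrt (x\<^sup>2 + 1)" for x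
    using c power_le_one[of c 2] by simp
  have D_nonneg: "?D x \<ge> 0" for x
    using le[of x] pos[of x] by (simp add: frac_le)
  have deriv: "DERIV ?F x :> ?D x" for x
  proof -
    have "DERIV ?F x :> 1 / sqrt ((x / c)\<^sup>2 + 1) * (1 / c) - 1 / sqrt (x\<^sup>2 + 1)"
      using DERIV_diff[OF DERIV_chain2[OF arsinh_real_has_field_derivative DERIV_cdivide[OF DERIV_ident]]
        arsinh_real_has_field_derivative] by simp
    moreover have "sqrt ((x / c)\<^sup>2 + 1) * c = sqrt (x\<^sup>2 + c\<^sup>2)"
    proof -
      have "sqrt ((x / c)\<^sup>2 + 1) * c = sqrt (((x / c)\<^sup>2 + 1) * c\<^sup>2)"
        using c by (simp add: real_sqrt_mult)
      also have "((x / c)\<^sup>2 + 1) * c\<^sup>2 = x\<^sup>2 + c\<^sup>2"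
        using c by (simp add: field_simps)
      finally show ?thesis .
    qed
    ultimately show ?thesis by simp
  qed
  have top: "(?F \<longlongrightarrow> ln (1 / c)) at_top"
  proof -
    have "ln (inverse c + inverse \<bar>c\<bar>) - ln 2 = ln (1 / c)"
      using c ln_mult[of 2 "inverse c"] by (simp add: inverse_eq_divide)
    then show ?thesis
      using c unfolding arsinh_real_def by real_asymp
  qed
  have bot: "(?F \<longlongrightarrow> - ln (1 / c)) at_bot"
  proof -
    have "((\<lambda>x. - ?F x) \<longlongrightarrow> - ln (1 / c)) at_top"
      by (intro tendsto_minus top)
    moreover have "- ?F x = ?F (- x)" for x
      by (simp add: arsinh_minus_real)
    ultimately show ?thesis
      by (simp add: filterlim_at_bot_mirror del: minus_diff_eq)
  qed
  have lim: "((?F \<circ> real_of_ereal) \<longlongrightarrow> - ln (1 / c)) (at_right (-\<infinity>))"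
      "((?F \<circ> real_of_ereal) \<longlongrightarrow> ln (1 / c)) (at_left \<infinity>)"
    using top bot by (simp_all add: ereal_tendsto_simps)
  have "set_integrable lborel (einterval (-\<infinity>) \<infinity>) ?D"
       "(LBINT x=-\<infinity>..\<infinity>. ?D x) = ln (1 / c) - (- ln (1 / c))"
    by (rule interval_integral_FTC_nonneg[OF _ deriv _ _ lim];
        use D_nonneg pos less_imp_neq[OF pos(1)] less_imp_neq[OF pos(2)] in
          \<open>force intro!: continuous_intros\<close>)+
  then have D: "integrable lborel ?D" "(LINT x|lborel. ?D x) = 2 * ln (1 / c)"
    by (simp_all add: set_integrable_def interval_lebesgue_integral_def set_lebesgue_integral_def)
  have C: "integrable lborel (\<lambda>x::real. 2 * (1 / (x\<^sup>2 + 1\<^sup>2)))"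
      "(LINT x::real|lborel. 2 * (1 / (x\<^sup>2 + 1\<^sup>2))) = 2 * pi"
    using cauchy_density_integral[OF zero_less_one]
    by (simp_all only: integral_mult_right_zero div_by_1 integrable_mult_right)
  have bounds: "?D x \<le> agm_integrand 1 c x \<and> agm_integrand 1 c x \<le> ?D x + 2 * (1 / (x\<^sup>2 + 1\<^sup>2))" for x
  proof -
    define A where "A = sqrt (x\<^sup>2 + 1)"
    define B where "B = sqrt (x\<^sup>2 + c\<^sup>2)"
    have A: "A \<ge> 1" "A\<^sup>2 = x\<^sup>2 + 1" and B: "B > 0" "B\<^sup>2 = x\<^sup>2 + c\<^sup>2"
      using pos[of x] by (auto simp: A_def B_def)
    have BA: "B \<le> A" using le[of x] by (simp add: A_def B_def)
    have A_le: "A \<le> 1 + B"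
    proof (rule power2_le_imp_le)
      show "A\<^sup>2 \<le> (1 + B)\<^sup>2" using A B by (simp add: power2_sum)
    qed (use B in simp)
    have E: "agm_integrand 1 c x = 1 / (A * B)"
      by (simp add: agm_integrand_def A_def B_def real_sqrt_mult)
    have DE: "?D x = (A - B) / (A * B)"
    proof -
      have "?D x = 1 / B - 1 / A" by (simp only: A_def B_def)
      then show ?thesis using A B by (simp add: field_simps)
    qed
    \<comment> \<open>For \<open>B \<le> 1\<close> the numerator \<open>1 - A + B\<close> is at most \<open>B\<close>, otherwise \<open>B\<close> is comparable to \<open>A\<close>.\<close>
    have "1 / (A * B) \<le> (A - B) / (A * B) + 2 / A\<^sup>2"
    proof -
      have "A * (1 - A + B) \<le> 2 * B"
      proof (cases "B \<le> 1")
        case True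
        have "B\<^sup>2 \<le> 1" using power_mono[OF True, of 2] B by simp
        then have "A\<^sup>2 \<le> 2\<^sup>2" using A(2) B(2) zero_le_power2[of c] unfolding power2_eq_square[of 2] by linarith
        then have "A \<le> 2" by (rule power2_le_imp_le) simp
        moreover have "1 - A + B \<le> B" "0 \<le> 1 - A + B" using A A_le by auto
        ultimately show ?thesis using B by (intro mult_mono) auto
      next
        case False
        then have "A \<le> 2 * B" using A_le by simp
        moreover have "1 - A + B \<le> 1" "0 \<le> 1 - A + B" using A_le BA by auto
        ultimately show ?thesis
          using mult_mono[of A "2 * B" "1 - A + B" 1] A B by simp
      qed
      then have "A * (1 - A + B) / (A\<^sup>2 * B) \<le> 2 * B / (A\<^sup>2 * B)"
        using B by (intro divide_right_mono) auto
      moreover have "A * (1 - A + B) / (A\<^sup>2 * B) = 1 / (A * B) - (A - B) / (A * B)"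
        using A(1) B(1) by (simp add: power2_eq_square diff_divide_distrib add_divide_distrib)
      moreover have "2 * B / (A\<^sup>2 * B) = 2 / A\<^sup>2"
        using B(1) by simp
      ultimately show ?thesis by simp
    qed
    moreover have "(A - B) / (A * B) \<le> 1 / (A * B)"
      using A_le A B by (intro divide_right_mono) auto
    ultimately show ?thesis using A(2) unfolding DE E by simp
  qed
  have ag: "integrable lborel (agm_integrand 1 c)" using c by (intro agm_integrable) auto
  show "2 * ln (1 / c) \<le> agm_integral 1 c"
    unfolding agm_integral_def D(2)[symmetric] by (intro integral_mono D ag) (use bounds in blast)
  have "agm_integral 1 c \<le> (LINT x|lborel. ?D x + 2 * (1 / (x\<^sup>2 + 1\<^sup>2)))"
    unfolding agm_integral_def
    by (intro integral_mono Bochner_Integration.integrable_add D C ag) (use bounds in blast)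
  also have "\<dots> = 2 * ln (1 / c) + 2 * pi"
    by (subst Bochner_Integration.integral_add[OF D(1) C(1)]) (simp only: D C)
  finally show "agm_integral 1 c \<le> 2 * ln (1 / c) + 2 * pi" .
qed

text \<open>
The substitution \<open>s = 1 - 1 / (1 + x^2)^2\<close> turns the Beta integral into four times the
  half-line integral.
\<close>
lemma agm_integral_lemniscate: "agm_integral 1 (sqrt 2) = Beta (1/2) (1/4) / 2"
proof -
  let ?f = "\<lambda>s::real. s powr (1/2 - 1) * (1 - s) powr (1/4 - 1)"
  let ?g = "\<lambda>x::real. 1 - 1 / (1 + x\<^sup>2)\<^sup>2" and ?g' = "\<lambda>x::real. 4 * x / (1 + x\<^sup>2) ^ 3"
  have pos: "1 + x\<^sup>2 > 0" for x :: real by (simp add: add_pos_nonneg)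
  have g: "0 < ?g x" "?g x < 1" if "x > 0" for x
  proof -
    have "(1 + x\<^sup>2)\<^sup>2 > 1" using that by (simp add: power2_eq_square algebra_simps add_pos_pos)
    then show "0 < ?g x" "?g x < 1" by (auto simp: pos less_imp_neq[OF pos, symmetric])
  qed
  have subst_eq: "?f (?g x) * ?g' x = 4 * agm_integrand 1 (sqrt 2) x" if x: "x > 0" for x
  proof -
    define w where "w = sqrt (1 + x\<^sup>2)"
    have w: "w > 0" "1 + x\<^sup>2 = w\<^sup>2" using pos[of x] by (auto simp: w_def)
    have "?g x = (x * sqrt (x\<^sup>2 + 2) / w\<^sup>2)\<^sup>2"
    proof -
      have "?g x = ((w\<^sup>2)\<^sup>2 - 1) / (w\<^sup>2)\<^sup>2" using w by (simp add: field_simps)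
      also have "(w\<^sup>2)\<^sup>2 - 1 = x\<^sup>2 * (x\<^sup>2 + 2)" unfolding w(2)[symmetric] by (simp add: power2_eq_square algebra_simps)
      finally show ?thesis by (simp add: power_mult_distrib power_divide)
    qed
    moreover have "y\<^sup>2 powr (1/2 - 1) = 1 / y" if "y > 0" for y :: real
      using that by (simp add: powr_minus powr_half_sqrt field_simps)
    ultimately have 1: "?g x powr (1/2 - 1) = w\<^sup>2 / (x * sqrt (x\<^sup>2 + 2))"
      using x w by (simp add: pos_add_strict)
    have "1 - ?g x = w powr (-4)"
      using w by (simp add: powr_minus_divide)
    then have 2: "(1 - ?g x) powr (1/4 - 1) = w ^ 3"
      using w by (simp add: powr_powr)
    have 3: "?g' x = 4 * x / w ^ 6" unfolding w(2) by simp
    have "?f (?g x) * ?g' x = 4 / (w * sqrt (x\<^sup>2 + 2))"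
      unfolding 1 2 3 using x w by (simp add: power_numeral_reduce)
    then show ?thesis
      by (simp add: agm_integrand_def w_def real_sqrt_mult add.commute)
  qed
  have lims: "((ereal \<circ> ?g \<circ> real_of_ereal) \<longlongrightarrow> ereal 0) (at_right (ereal 0))"
      "((ereal \<circ> ?g \<circ> real_of_ereal) \<longlongrightarrow> ereal 1) (at_left \<infinity>)"
  proof -
    have "(?g \<longlongrightarrow> 0) (at_right 0)" "(?g \<longlongrightarrow> 1) at_top" by real_asymp+
    then show "((ereal \<circ> ?g \<circ> real_of_ereal) \<longlongrightarrow> ereal 0) (at_right (ereal 0))"
      "((ereal \<circ> ?g \<circ> real_of_ereal) \<longlongrightarrow> ereal 1) (at_left \<infinity>)"
      by (simp_all only: ereal_tendsto_simps)
  qed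
  have int: "set_integrable lborel (einterval (ereal 0) \<infinity>) (\<lambda>x. ?f (?g x) * ?g' x)"
  proof -
    have "set_integrable lborel (einterval (ereal 0) \<infinity>) (\<lambda>x. 4 * agm_integrand 1 (sqrt 2) x)"
      unfolding set_integrable_def
      by (intro integrable_mult_indicator integrable_mult_right agm_integrable) auto
    then show ?thesis
      by (rule set_integrable_cong[THEN iffD2, rotated -1])
         (simp_all only: einterval_iff subst_eq zero_ereal_def less_ereal.simps)
  qed
  have deriv: "DERIV ?g x :> ?g' x" for x
    using pos[of x] less_imp_neq[OF pos[of x]] by (auto intro!: derivative_eq_intros simp: power_numeral_reduce)
  have contf: "isCont ?f (?g x)" if "x > 0" for x
    using g[OF that] by (intro continuous_intros) auto
  have contg': "isCont ?g' x" for x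
    using less_imp_neq[OF pos[of x]] by (intro continuous_intros) auto
  note sub = interval_integral_substitution_nonneg[where a = "ereal 0" and b = \<infinity> and f = ?f and g = ?g
      and g' = ?g', OF _ deriv contf contg' _ _ lims int]
  have set: "set_integrable lborel (einterval (ereal 0) (ereal 1)) ?f"
    by (rule sub(1)) auto
  have "(LBINT s=ereal 0..ereal 1. ?f s) = (LBINT x=ereal 0..\<infinity>. ?f (?g x) * ?g' x)"
    by (rule sub(2)) auto
  also have "\<dots> = (LBINT x=ereal 0..\<infinity>. 4 * agm_integrand 1 (sqrt 2) x)"
    by (intro interval_integral_cong subst_eq) (simp add: einterval_iff)
  also have "\<dots> = 2 * agm_integral 1 (sqrt 2)"
    by (simp add: agm_integral_halves flip: zero_ereal_def)
  finally have "2 * agm_integral 1 (sqrt 2) = (LBINT s:einterval (ereal 0) (ereal 1). ?f s)"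
    by (simp add: interval_lebesgue_integral_def)
  also have "\<dots> = integral {0<..<1} ?f"
    using set_borel_integral_eq_integral(2)[OF set] by simp
  also have "\<dots> = Beta (1/2) (1/4)"
    using has_integral_Beta_real[of "1/2" "1/4"] by (intro integral_unique) (simp add: has_integral_Icc_iff_Ioo)
  finally show ?thesis by simp
qed

section \<open>The product formula for phi\<close>

text \<open>
The finite q-Pochhammer symbol \<open>(q; q)\<^sub>n\<close>.
\<close>
definition qfact :: "'a::{real_normed_field, banach} \<Rightarrow> nat \<Rightarrow> 'a" where
  "qfact q n = (\<Prod>k=1..n. 1 - q ^ k)"

text \<open>
The partial products of \<open>(q; q) / (-q; q)\<close>, Gauss's product for \<open>\<phi>(-q)\<close>.
\<close>
definition gauss_prod :: "'a::{real_normed_field, banach} \<Rightarrow> nat \<Rightarrow> 'a" where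
  "gauss_prod q n = (\<Prod>k=1..n. (1 - q ^ k) / (1 + q ^ k))"

lemma power_neq_one:
  fixes q :: "'a::real_normed_field"
  assumes "norm q < 1" "k > 0"
  shows "q ^ k \<noteq> 1" "1 + q ^ k \<noteq> 0"
proof -
  have "norm (q ^ k) < 1"
    using assms by (simp add: norm_power power_less_one_iff)
  then show "q ^ k \<noteq> 1" "1 + q ^ k \<noteq> 0"
    by (auto simp: add_eq_0_iff)
qed

lemma qfact_0 [simp]: "qfact q 0 = 1"
  by (simp add: qfact_def)

lemma qfact_Suc: "qfact q (Suc n) = qfact q n * (1 - q ^ Suc n)"
  by (simp add: qfact_def)

lemma qfact_nonzero: "norm q < 1 \<Longrightarrow> qfact q n \<noteq> 0"
  by (simp add: qfact_def power_neq_one)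

text \<open>
The limit is not 0, so both \<open>qfact q\<close> and its inverse are bounded; this is what dominates the series
  in the proof of the product formula.
\<close>
lemma qfact_limit:
  assumes q: "norm (q::'a::{real_normed_field, banach}) < 1"
  obtains L where "L \<noteq> 0" "qfact q \<longlonglongrightarrow> L"
proof -
  have "summable (\<lambda>k. norm (q ^ Suc k))"
    using q by (simp add: norm_power norm_mult summable_geometric summable_mult)
  then have "abs_convergent_prod (\<lambda>k. 1 - q ^ Suc k)"
    by (intro summable_imp_abs_convergent_prod) simp
  then have "convergent_prod (\<lambda>k. 1 - q ^ Suc k)"
    by (rule abs_convergent_prod_imp_convergent_prod)
  then obtain L where L: "L \<noteq> 0" "(\<lambda>n. \<Prod>k\<le>n. 1 - q ^ Suc k) \<longlonglongrightarrow> L"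
    using power_neq_one(1)[OF q] by (subst (asm) convergent_prod_iff_nz_lim) (auto simp del: power_Suc)
  have "(\<Prod>k\<le>n. 1 - q ^ Suc k) = qfact q (Suc n)" for n
    unfolding qfact_def by (rule prod.reindex_bij_witness[of _ "\<lambda>k. k - 1" Suc]) auto
  with L show ?thesis
    by (intro that[of L]) (simp_all add: filterlim_sequentially_Suc)
qed

text \<open>
A symmetric sum of these terms over \<open>-n, ..., n\<close> is a truncation of the series of \<open>\<phi>(-q)\<close> with
  weights, which has a closed form for every \<open>n\<close>; only the half \<open>j \<ge> 0\<close> is kept, and the subtraction
  \<open>n - j\<close> is used for \<open>j \<le> n\<close> only.
\<close>
definition gauss_term :: "'a::{real_normed_field, banach} \<Rightarrow> nat \<Rightarrow> nat \<Rightarrow> 'a" where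
  "gauss_term q n j = (- 1) ^ j * q ^ (j\<^sup>2) / (qfact q (n - j) * qfact q (n + j))"

text \<open>
With \<open>X = q^(n-j)\<close>, \<open>Y = q^(n+j)\<close> and \<open>n = m + 1\<close>, the difference of the terms is a multiple of
  \<open>(1 - X Y) / ((1 - X)(1 - Y)) - 1 = X / (1 - X) + Y / (1 - Y)\<close>. The \<open>X\<close> part for \<open>j\<close> cancels the
  \<open>Y\<close> part for \<open>j - 1\<close>, so the sum telescopes.
\<close>
lemma gauss_term_telescope:
  fixes q :: "'a::{real_normed_field, banach}"
  assumes q: "norm q < 1" and i: "i \<le> m"
  defines "v \<equiv> \<lambda>i. (- 1) ^ i * q ^ (i\<^sup>2 + i + Suc m) / (qfact q (m - i) * qfact q (Suc m + i))"
  shows "(\<Sum>j=1..i. (1 - q ^ (2 * Suc m)) * gauss_term q (Suc m) j - gauss_term q m j) = v i - v 0"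
  using i
proof (induction i)
  case (Suc i)
  define A where "A = qfact q (m - Suc i)"
  define B where "B = qfact q (Suc m + i)"
  define X where "X = q ^ (m - i)"
  define Y where "Y = q ^ (Suc m + Suc i)"
  define s where "s = (- 1) ^ Suc i * q ^ ((Suc i)\<^sup>2)"
  have A: "A \<noteq> 0" and B: "B \<noteq> 0"
    using qfact_nonzero[OF q] by (simp_all add: A_def B_def)
  have X: "1 - X \<noteq> 0" and Y: "1 - Y \<noteq> 0"
    unfolding X_def Y_def using q Suc.prems power_neq_one(1)[OF q] by (simp_all del: power_Suc add_Suc add_Suc_right)
  have mi: "m - i = Suc (m - Suc i)" using Suc.prems by simp
  have qA: "qfact q (m - i) = A * (1 - X)"
    by (simp add: mi qfact_Suc A_def X_def)
  have qB: "qfact q (Suc m + Suc i) = B * (1 - Y)"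
    by (simp add: qfact_Suc B_def Y_def)
  have XY: "q ^ (2 * Suc m) = X * Y"
    using Suc.prems unfolding X_def Y_def power_add[symmetric] by (intro arg_cong[where f = "(^) q"]) simp
  have g1: "gauss_term q (Suc m) (Suc i) = s / (A * (1 - X) * (B * (1 - Y)))"
    unfolding gauss_term_def qB diff_Suc_Suc qA s_def ..
  have g2: "gauss_term q m (Suc i) = s / (A * B)"
    by (simp add: gauss_term_def A_def B_def s_def)
  have v1: "v (Suc i) = s * Y / (A * (B * (1 - Y)))"
    unfolding v_def qB A_def[symmetric] by (simp add: s_def Y_def power_add)
  have v2: "v i = - (s * X) / (A * (1 - X) * B)"
  proof -
    have "(Suc i)\<^sup>2 + (m - i) = i\<^sup>2 + i + Suc m"
      using Suc.prems by (simp add: power2_eq_square)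
    then have "q ^ (i\<^sup>2 + i + Suc m) = q ^ ((Suc i)\<^sup>2) * X"
      unfolding X_def by (metis power_add)
    then show ?thesis
      unfolding v_def qA B_def[symmetric] by (simp add: s_def)
  qed
  have "(1 - q ^ (2 * Suc m)) * gauss_term q (Suc m) (Suc i) - gauss_term q m (Suc i) = v (Suc i) - v i"
    unfolding XY g1 g2 v1 v2 using A B X Y by (simp add: divide_simps) (simp add: algebra_simps)
  then show ?case
    using Suc by simp
qed simp

text \<open>
The symmetric sum \<open>D n\<close> of the terms satisfies \<open>(1 - q^(2n)) D n = D (n-1)\<close>: the telescoped sum, the
  term \<open>j = 0\<close> (counted once) and the term \<open>j = n\<close> (absent for \<open>n - 1\<close>) cancel. A \<open>z\<close>-free substitute
  for the finite form of Jacobi's triple product.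
\<close>
lemma finite_gauss_identity:
  fixes q :: "'a::{real_normed_field, banach}"
  assumes q: "norm q < 1"
  shows "(gauss_term q n 0 + 2 * (\<Sum>j=1..n. gauss_term q n j)) * qfact (q\<^sup>2) n = 1"
proof (induction n)
  case 0
  then show ?case by (simp add: gauss_term_def)
next
  case (Suc m)
  define R where "R = 1 - q ^ (2 * Suc m)"
  define Z where "Z = 1 - q ^ Suc m"
  define Q where "Q = qfact q m"
  define w where "w = (1 - Z) / (Q * (Q * Z))"
  have Q: "Q \<noteq> 0" and Z: "Z \<noteq> 0" using qfact_nonzero[OF q] power_neq_one[OF q] by (simp_all add: Q_def Z_def del: power_Suc)
  have RZ: "R = Z * (2 - Z)"
    unfolding R_def Z_def by (simp only: power_mult power2_eq_square mult_2 power_add) (simp add: algebra_simps)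
  have zero: "R * gauss_term q (Suc m) 0 - gauss_term q m 0 = 2 * w"
  proof -
    have g: "gauss_term q (Suc m) 0 = 1 / ((Q * Z) * (Q * Z))" "gauss_term q m 0 = 1 / (Q * Q)"
      by (simp_all add: gauss_term_def qfact_Suc Q_def Z_def)
    show ?thesis
      unfolding RZ g w_def using Q Z by (simp add: field_simps)
  qed
  have last: "R * gauss_term q (Suc m) (Suc m) = - ((- 1) ^ m * q ^ (m\<^sup>2 + m + Suc m) / qfact q (Suc m + m))"
  proof -
    have "qfact q (Suc m + Suc m) = qfact q (Suc m + m) * R"
      by (simp add: qfact_Suc R_def mult_2)
    moreover have "R \<noteq> 0" using power_neq_one(1)[OF q, of "2 * Suc m"] by (simp add: R_def)
    moreover have "(Suc m)\<^sup>2 = m\<^sup>2 + m + Suc m" by (simp add: power2_eq_square)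
    ultimately show ?thesis
      by (simp add: gauss_term_def)
  qed
  have "R * (\<Sum>j=1..Suc m. gauss_term q (Suc m) j) - (\<Sum>j=1..m. gauss_term q m j)
     = R * gauss_term q (Suc m) (Suc m) + (\<Sum>j=1..m. R * gauss_term q (Suc m) j - gauss_term q m j)"
    by (simp add: sum_subtractf sum_distrib_left algebra_simps)
  also have "\<dots> = - w"
    unfolding gauss_term_telescope[OF q order.refl[of m], folded R_def] last
    by (simp add: qfact_Suc w_def Q_def Z_def)
  finally have rest: "R * (\<Sum>j=1..Suc m. gauss_term q (Suc m) j) - (\<Sum>j=1..m. gauss_term q m j) = - w" .
  have rearrange: "R * (g0 + 2 * T) - (h0 + 2 * S) = (R * g0 - h0) + 2 * (R * T - S)" for g0 h0 S T
    by (simp add: algebra_simps)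
  from rearrange[of "gauss_term q (Suc m) 0" "\<Sum>j=1..Suc m. gauss_term q (Suc m) j"
      "gauss_term q m 0" "\<Sum>j=1..m. gauss_term q m j"]
  have "R * (gauss_term q (Suc m) 0 + 2 * (\<Sum>j=1..Suc m. gauss_term q (Suc m) j))
      = gauss_term q m 0 + 2 * (\<Sum>j=1..m. gauss_term q m j)"
    unfolding zero rest by simp
  moreover have "qfact (q\<^sup>2) (Suc m) = qfact (q\<^sup>2) m * R"
    by (simp only: qfact_Suc R_def power_mult)
  moreover have "x * (y * R) = (R * x) * y" for x y :: 'a
    by simp
  ultimately show ?case
    using Suc by (simp only:)
qed

text \<open>
Multiplied by \<open>(q; q)\<^sub>n ^ 2\<close>, the finite identity becomes a series whose weights
  tend to 1 as \<open>n\<close> grows.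
\<close>
lemma gauss_prod_finite_sum:
  fixes q :: "'a::{real_normed_field, banach}"
  assumes q: "norm q < 1"
  shows "gauss_prod q n = 1 + 2 * (\<Sum>j=1..n. (- 1) ^ j * q ^ (j\<^sup>2) *
            ((qfact q n)\<^sup>2 / (qfact q (n - j) * qfact q (n + j))))"
proof -
  let ?D = "gauss_term q n 0 + 2 * (\<Sum>j=1..n. gauss_term q n j)"
  let ?N = "\<Prod>k=1..n. 1 + q ^ k"
  have N: "?N \<noteq> 0" using power_neq_one(2)[OF q] by simp
  have sq: "qfact (q\<^sup>2) n = qfact q n * ?N"
    unfolding qfact_def prod.distrib[symmetric]
    by (intro prod.cong refl) (simp add: power2_eq_square power_mult_distrib algebra_simps)
  have "gauss_prod q n = qfact q n / ?N"
    by (simp add: gauss_prod_def qfact_def prod_dividef)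
  also have "\<dots> = (qfact q n)\<^sup>2 * ?D"
  proof -
    have "(qfact q n)\<^sup>2 * ?D * ?N = qfact q n * (?D * (qfact q n * ?N))"
      by (simp add: power2_eq_square mult_ac)
    also have "\<dots> = qfact q n"
      using finite_gauss_identity[OF q, of n] unfolding sq by simp
    finally show ?thesis
      using N by (simp add: divide_eq_eq)
  qed
  also have "\<dots> = 1 + 2 * (\<Sum>j=1..n. (- 1) ^ j * q ^ (j\<^sup>2) *
            ((qfact q n)\<^sup>2 / (qfact q (n - j) * qfact q (n + j))))"
    using qfact_nonzero[OF q, of n]
    by (simp add: gauss_term_def algebra_simps sum_distrib_left power2_eq_square)
  finally show ?thesis .
qed

text \<open>
The weights in \<open>gauss_prod_finite_sum\<close> tend to 1 and are bounded, so Tannery's theorem applies with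
  the geometric series as majorant.
\<close>
proposition gauss_product:
  fixes q :: "'a::{real_normed_field, banach}"
  assumes q: "norm q < 1"
  shows "gauss_prod q \<longlonglongrightarrow> ramanujan_phi (- q)"
proof -
  obtain L where L: "L \<noteq> 0" "qfact q \<longlonglongrightarrow> L" using qfact_limit[OF q] .
  have "Bseq (qfact q)" using L convergentI convergent_imp_Bseq by blast
  then obtain M where M: "\<And>n. norm (qfact q n) \<le> M" "M > 0" by (auto simp: Bseq_def)
  have "Bseq (\<lambda>n. inverse (qfact q n))"
    using tendsto_inverse[OF L(2,1)] convergentI convergent_imp_Bseq by blast
  then obtain K where K: "\<And>n. norm (inverse (qfact q n)) \<le> K" "K > 0" by (auto simp: Bseq_def)
  define ratio where "ratio n j = (qfact q n)\<^sup>2 / (qfact q (n - j) * qfact q (n + j))" for n j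
  define a where "a j n = (if j < n then (- q) ^ ((Suc j)\<^sup>2) * ratio n (Suc j) else 0)" for j n
  \<comment> \<open>Truncated subtraction makes \<open>ratio n j\<close> meaningless for \<open>j > n\<close>, but the bound holds there as well.\<close>
  have ratio_bound: "norm (ratio n j) \<le> M\<^sup>2 * K\<^sup>2" for n j
  proof -
    have "norm (ratio n j) = (norm (qfact q n))\<^sup>2 * (norm (inverse (qfact q (n - j))) * norm (inverse (qfact q (n + j))))"
      by (simp add: ratio_def norm_mult norm_divide norm_power norm_inverse field_simps)
    also have "\<dots> \<le> M\<^sup>2 * (K * K)"
      using M K by (intro mult_mono power_mono) (auto simp: less_imp_le)
    finally show ?thesis by (simp add: power2_eq_square)
  qed
  have ratio_limit: "(\<lambda>n. ratio n j) \<longlonglongrightarrow> 1" for j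
  proof -
    have "(\<lambda>n. qfact q (n - j)) \<longlonglongrightarrow> L" "(\<lambda>n. qfact q (n + j)) \<longlonglongrightarrow> L"
      using filterlim_compose[OF L(2) filterlim_minus_const_nat_at_top] LIMSEQ_ignore_initial_segment[OF L(2)]
      by auto
    then have "(\<lambda>n. ratio n j) \<longlonglongrightarrow> L\<^sup>2 / (L * L)"
      unfolding ratio_def using L by (intro tendsto_intros) auto
    then show ?thesis using L by (simp add: power2_eq_square)
  qed
  have neg: "(- 1) ^ j * q ^ (j\<^sup>2) = (- q) ^ (j\<^sup>2)" for j
    by (simp add: power_minus[of q "j\<^sup>2"] power2_eq_square minus_one_power_iff)
  have fin: "gauss_prod q n = 1 + 2 * (\<Sum>j. a j n)" for n
  proof -
    have "(\<Sum>j. a j n) = (\<Sum>j<n. a j n)"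
      by (rule suminf_finite) (auto simp: a_def)
    also have "\<dots> = (\<Sum>j=1..n. (- q) ^ (j\<^sup>2) * ratio n j)"
      by (rule sum.reindex_bij_witness[of _ "\<lambda>k. k - 1" Suc]) (auto simp: a_def)
    finally show ?thesis
      by (simp add: gauss_prod_finite_sum[OF q] neg ratio_def)
  qed
  have "(\<lambda>n. \<Sum>j. a j n) \<longlonglongrightarrow> (\<Sum>j. (- q) ^ ((Suc j)\<^sup>2))"
  proof (rule tannerys_theorem[THEN conjunct2, THEN conjunct2])
    show "(\<lambda>n. a j n) \<longlonglongrightarrow> (- q) ^ ((Suc j)\<^sup>2)" for j
    proof (rule Lim_transform_eventually)
      show "(\<lambda>n. (- q) ^ ((Suc j)\<^sup>2) * ratio n (Suc j)) \<longlonglongrightarrow> (- q) ^ ((Suc j)\<^sup>2)"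
        using tendsto_mult[OF tendsto_const ratio_limit] by simp
      show "\<forall>\<^sub>F n in sequentially. (- q) ^ ((Suc j)\<^sup>2) * ratio n (Suc j) = a j n"
        using eventually_gt_at_top[of j] by eventually_elim (simp add: a_def)
    qed
    show "summable (\<lambda>j. norm q ^ j * (M\<^sup>2 * K\<^sup>2))"
      using q by (intro summable_mult2 summable_geometric) simp
    have "norm (a j n) \<le> norm q ^ j * (M\<^sup>2 * K\<^sup>2)" for j n
    proof (cases "j < n")
      case True
      have "norm q ^ ((Suc j)\<^sup>2) \<le> norm q ^ j"
        using q by (intro power_decreasing) (auto simp: power2_eq_square)
      then show ?thesis
        using True ratio_bound by (auto simp: a_def norm_mult norm_power intro!: mult_mono)
    qed (simp add: a_def)
    then show "\<forall>\<^sub>F (j, n) in at_top \<times>\<^sub>F sequentially. norm (a j n) \<le> norm q ^ j * (M\<^sup>2 * K\<^sup>2)"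
      by (intro always_eventually) auto
  qed simp
  then have "(\<lambda>n. 1 + 2 * (\<Sum>j. a j n)) \<longlonglongrightarrow> 1 + 2 * (\<Sum>j. (- q) ^ ((Suc j)\<^sup>2))"
    by (intro tendsto_intros)
  then show ?thesis
    using q by (simp add: ramanujan_phi_eq fin[abs_def])
qed

text \<open>
The factors for odd exponents \<open>k\<close> at \<open>q\<close> and at \<open>-q\<close> are inverse to each other, those for
  even \<open>k\<close> coincide.
\<close>
lemma gauss_prod_double:
  fixes q :: "'a::{real_normed_field, banach}"
  assumes q: "norm q < 1"
  shows "gauss_prod q (2 * n) * gauss_prod (- q) (2 * n) = (gauss_prod (q\<^sup>2) n)\<^sup>2"
proof (induction n)
  case (Suc n)
  let ?F = "\<lambda>x::'a. (1 - x) / (1 + x)"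
  have F: "?F (q ^ (2 * n + 1)) * ?F (- (q ^ (2 * n + 1))) = 1"
    using power_neq_one[OF q, of "2 * n + 1"] by (simp del: power_Suc)
  have P: "gauss_prod q (2 * Suc n) = gauss_prod q (2 * n) * ?F (q ^ (2 * n + 1)) * ?F (q ^ (2 * n + 2))"
    for q :: 'a
    by (simp add: gauss_prod_def)
  have "gauss_prod q (2 * Suc n) * gauss_prod (- q) (2 * Suc n)
    = (gauss_prod q (2 * n) * gauss_prod (- q) (2 * n)) *
      (?F (q ^ (2 * n + 1)) * ?F (- (q ^ (2 * n + 1)))) * (?F (q ^ (2 * n + 2)))\<^sup>2"
    unfolding P by (simp add: power2_eq_square)
  also have "\<dots> = (gauss_prod (q\<^sup>2) n * ?F ((q\<^sup>2) ^ Suc n))\<^sup>2"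
    unfolding F Suc by (simp only: power_mult_distrib power_mult[symmetric]) (simp add: algebra_simps)
  also have "\<dots> = (gauss_prod (q\<^sup>2) (Suc n))\<^sup>2"
    by (simp add: gauss_prod_def)
  finally show ?case .
qed (simp add: gauss_prod_def)

lemma phi_mult_phi_minus:
  fixes q :: "'a::{real_normed_field, banach}"
  assumes q: "norm q < 1"
  shows "ramanujan_phi q * ramanujan_phi (- q) = (ramanujan_phi (- q\<^sup>2))\<^sup>2"
proof (rule LIMSEQ_unique)
  have sub: "strict_mono (\<lambda>n::nat. 2 * n)" by (simp add: strict_mono_def)
  have q2: "norm (q\<^sup>2) < 1" using q by (simp add: norm_power power_less_one_iff)
  show "(\<lambda>n. gauss_prod q (2 * n) * gauss_prod (- q) (2 * n)) \<longlonglongrightarrow> ramanujan_phi q * ramanujan_phi (- q)"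
    using tendsto_mult[OF LIMSEQ_subseq_LIMSEQ[OF gauss_product[of q] sub]
        LIMSEQ_subseq_LIMSEQ[OF gauss_product[of "- q"] sub]] q by (simp add: o_def mult.commute)
  show "(\<lambda>n. gauss_prod q (2 * n) * gauss_prod (- q) (2 * n)) \<longlonglongrightarrow> (ramanujan_phi (- q\<^sup>2))\<^sup>2"
    unfolding gauss_prod_double[OF q] by (intro tendsto_power gauss_product q2)
qed

section \<open>Products over roots of unity\<close>

abbreviation unity_roots :: "nat \<Rightarrow> complex set" where
  "unity_roots p \<equiv> {z. z ^ p = 1}"

lemma norm_unity_root: "p > 0 \<Longrightarrow> z \<in> unity_roots p \<Longrightarrow> norm z = 1"
  using power_eq_1_iff[of z p] by auto

text \<open>
The homogeneous form of the factorization of \<open>X^p - 1\<close> into linear factors.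
\<close>
lemma prod_unity_roots_diff:
  assumes p: "p > 0"
  shows "(\<Prod>z\<in>unity_roots p. x - z * y) = x ^ p - y ^ p"
proof (cases "y = 0")
  case True
  then show ?thesis using p card_roots_unity_eq[of p] by simp
next
  case False
  define f :: "complex poly" where "f = monom 1 p - 1"
  have poly_f: "poly f z = z ^ p - 1" for z by (simp add: f_def poly_monom)
  have deg: "degree f = p"
    using p degree_add_eq_left[of "- 1" "monom (1::complex) p"] by (simp add: f_def degree_monom_eq)
  then have lead: "lead_coeff f = 1" using p by (simp add: f_def)
  have "rsquarefree f"
    unfolding rsquarefree_roots
  proof (intro allI notI, elim conjE)
    fix a assume "poly f a = 0" "poly (pderiv f) a = 0"
    then have "a ^ p = 1" "of_nat p * a ^ (p - 1) = 0"
      by (simp_all add: poly_f) (simp add: f_def pderiv_diff pderiv_monom poly_monom)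
    then show False using p by (auto simp: power_0_left)
  qed
  then have "f = (\<Prod>z\<in>{z. poly f z = 0}. [:- z, 1:])"
    using complex_poly_decompose_rsquarefree[of f] lead by simp
  also have "{z. poly f z = 0} = unity_roots p"
    by (simp add: poly_f)
  finally have "poly f (x / y) = poly (\<Prod>z\<in>unity_roots p. [:- z, 1:]) (x / y)"
    by (rule arg_cong)
  then have "poly f (x / y) = (\<Prod>z\<in>unity_roots p. x / y - z)"
    by (simp add: poly_prod)
  then have "y ^ p * ((x / y) ^ p - 1) = y ^ card (unity_roots p) * (\<Prod>z\<in>unity_roots p. x / y - z)"
    using p card_roots_unity_eq[of p] by (simp add: poly_f)
  also have "\<dots> = (\<Prod>z\<in>unity_roots p. y * (x / y - z))"
    by (simp add: prod.distrib)
  also have "\<dots> = (\<Prod>z\<in>unity_roots p. x - z * y)"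
    using False by (intro prod.cong) (auto simp: field_simps)
  finally show ?thesis
    using False by (simp add: right_diff_distrib power_divide)
qed

lemma prod_unity_roots_add:
  assumes "odd p"
  shows "(\<Prod>z\<in>unity_roots p. x + z * y) = x ^ p + y ^ p"
  using prod_unity_roots_diff[of p x "- y"] assms by (simp add: odd_pos)

lemma bij_betw_power_unity_roots:
  assumes p: "p > 1" and cop: "coprime k p"
  shows "bij_betw (\<lambda>z. z ^ k) (unity_roots p) (unity_roots p)"
proof -
  have "k \<noteq> 0" using p cop by (metis coprime_0_left_iff nat_dvd_1_iff_1 less_irrefl)
  then obtain x y where xy: "k * x = p * y + 1"
    using bezout_nat[of k p] cop by (auto simp: coprime_iff_gcd_eq_1)
  have *: "z ^ (k * x) = z" if "z \<in> unity_roots p" for z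
    using that unfolding xy by (simp add: power_add power_mult)
  have **: "z ^ n \<in> unity_roots p" if "z \<in> unity_roots p" for z n
  proof -
    have "(z ^ n) ^ p = (z ^ p) ^ n" by (metis power_mult mult.commute)
    then show ?thesis using that by simp
  qed
  show ?thesis
    by (rule bij_betw_byWitness[where f' = "\<lambda>z. z ^ x"])
       (use * ** in \<open>simp_all add: image_subset_iff mult.commute[of x k] flip: power_mult\<close>)
qed

text \<open>
The map \<open>z \<mapsto> z^k\<close> permutes the \<open>p\<close>-th roots of unity if \<open>p\<close> does not divide \<open>k\<close>, and is constantly
  1 otherwise. Since \<open>p\<close> is odd, the denominators multiply to \<open>x^p + y^p\<close>.
\<close>
lemma gauss_factor_unity_roots:
  fixes q :: complex
  assumes p: "prime p" "odd p"
  shows "(\<Prod>z\<in>unity_roots p. (1 - (z * q) ^ k) / (1 + (z * q) ^ k)) =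
    (if p dvd k then ((1 - q ^ k) / (1 + q ^ k)) ^ p else (1 - (q ^ p) ^ k) / (1 + (q ^ p) ^ k))"
proof (cases "p dvd k")
  case True
  then obtain m where k: "k = p * m" by auto
  have "(z * q) ^ k = q ^ k" if "z \<in> unity_roots p" for z
    using that by (simp add: power_mult_distrib k power_mult)
  then have "(\<Prod>z\<in>unity_roots p. (1 - (z * q) ^ k) / (1 + (z * q) ^ k))
      = (\<Prod>z\<in>unity_roots p. (1 - q ^ k) / (1 + q ^ k))"
    by (intro prod.cong) auto
  then show ?thesis using True p card_roots_unity_eq[of p] by (simp add: prime_gt_0_nat)
next
  case False
  then have "coprime k p" using prime_imp_coprime[of p k] p by (simp add: coprime_commute)
  then have bij: "bij_betw (\<lambda>z. z ^ k) (unity_roots p) (unity_roots p)"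
    using p by (intro bij_betw_power_unity_roots prime_gt_1_nat)
  have "(\<Prod>z\<in>unity_roots p. (1 - (z * q) ^ k) / (1 + (z * q) ^ k))
      = (\<Prod>z\<in>unity_roots p. (1 - z ^ k * q ^ k) / (1 + z ^ k * q ^ k))"
    by (simp add: power_mult_distrib)
  also have "\<dots> = (\<Prod>z\<in>unity_roots p. (1 - z * q ^ k) / (1 + z * q ^ k))"
    using prod.reindex_bij_betw[OF bij, of "\<lambda>w. (1 - w * q ^ k) / (1 + w * q ^ k)"] by simp
  also have "\<dots> = (1 - (q ^ k) ^ p) / (1 + (q ^ k) ^ p)"
    using p by (simp add: prod_dividef prod_unity_roots_diff prod_unity_roots_add prime_gt_0_nat)
  finally show ?thesis using False by (simp add: mult.commute flip: power_mult)
qed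

text \<open>
Only the factors with \<open>p\<close> dividing \<open>k\<close> deviate from those of \<open>gauss_prod (q^p)\<close>; they supply the
  \<open>p\<close>-th power on the right, and the extra factor on the left puts back what they miss.
\<close>
lemma gauss_prod_unity_roots:
  fixes q :: complex
  assumes p: "prime p" "odd p"
  shows "(\<Prod>z\<in>unity_roots p. gauss_prod (z * q) (p * n)) * gauss_prod (q ^ p\<^sup>2) n
    = gauss_prod (q ^ p) (p * n) * gauss_prod (q ^ p) n ^ p"
proof -
  let ?F = "\<lambda>x::complex. (1 - x) / (1 + x)"
  let ?A = "{1..p * n}" and ?M = "(\<lambda>m. p * m) ` {1..n}"
  have p0: "p > 0" using p by (simp add: prime_gt_0_nat)
  have M: "?M \<subseteq> ?A" using p0 by (auto simp: Suc_le_eq)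
  have dvd: "p dvd k \<longleftrightarrow> k \<in> ?M" if "k \<in> ?A" for k
    using that p0 by (auto simp: Suc_le_eq elim!: dvdE)
  have inj: "inj_on (\<lambda>m. p * m) {1..n}" using p0 by (auto simp: inj_on_def)
  have "(\<Prod>z\<in>unity_roots p. gauss_prod (z * q) (p * n))
      = (\<Prod>k\<in>?A. \<Prod>z\<in>unity_roots p. ?F ((z * q) ^ k))"
    unfolding gauss_prod_def by (rule prod.swap)
  also have "\<dots> = (\<Prod>k\<in>?A. if p dvd k then ?F (q ^ k) ^ p else ?F ((q ^ p) ^ k))"
    by (simp only: gauss_factor_unity_roots[OF p])
  also have "\<dots> = (\<Prod>k\<in>?A - ?M. ?F ((q ^ p) ^ k)) * (\<Prod>k\<in>?M. ?F (q ^ k) ^ p)"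
    by (subst prod.subset_diff[OF M], simp, intro arg_cong2[where f = "(*)"] prod.cong)
       (use M in \<open>auto simp: dvd\<close>)
  also have "(\<Prod>k\<in>?M. ?F (q ^ k) ^ p) = gauss_prod (q ^ p) n ^ p"
    using inj by (simp add: prod.reindex gauss_prod_def prod_power_distrib power_mult)
  finally have "(\<Prod>z\<in>unity_roots p. gauss_prod (z * q) (p * n))
      = (\<Prod>k\<in>?A - ?M. ?F ((q ^ p) ^ k)) * gauss_prod (q ^ p) n ^ p" .
  moreover have "gauss_prod (q ^ p\<^sup>2) n = (\<Prod>k\<in>?M. ?F ((q ^ p) ^ k))"
    using inj by (simp add: prod.reindex gauss_prod_def power_mult power2_eq_square)
  moreover have "gauss_prod (q ^ p) (p * n) = (\<Prod>k\<in>?A - ?M. ?F ((q ^ p) ^ k)) * (\<Prod>k\<in>?M. ?F ((q ^ p) ^ k))"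
    unfolding gauss_prod_def by (rule prod.subset_diff[OF M]) simp
  ultimately show ?thesis by simp
qed

proposition phi_unity_roots:
  fixes q :: complex
  assumes p: "prime p" "odd p" and q: "norm q < 1"
  shows "(\<Prod>z\<in>unity_roots p. ramanujan_phi (z * q)) * ramanujan_phi (q ^ p\<^sup>2) = ramanujan_phi (q ^ p) ^ Suc p"
proof -
  have p0: "p > 0" using p by (simp add: prime_gt_0_nat)
  have sub: "strict_mono (\<lambda>n. p * n)" using p0 by (simp add: strict_mono_def)
  have qp: "norm ((- q) ^ p) < 1" "norm ((- q) ^ p\<^sup>2) < 1"
    using q p0 by (simp_all add: norm_power power_less_one_iff)
  have zq: "norm (z * - q) < 1" if "z \<in> unity_roots p" for z
    using q norm_unity_root[OF p0 that] by (simp add: norm_mult)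
  have odd_p: "- ((- q) ^ p) = q ^ p" "- ((- q) ^ p\<^sup>2) = q ^ p\<^sup>2"
    using p by simp_all
  have lim1: "(\<lambda>n. (\<Prod>z\<in>unity_roots p. gauss_prod (z * - q) (p * n)) * gauss_prod ((- q) ^ p\<^sup>2) n)
      \<longlonglongrightarrow> (\<Prod>z\<in>unity_roots p. ramanujan_phi (- (z * - q))) * ramanujan_phi (- ((- q) ^ p\<^sup>2))"
    by (intro tendsto_mult tendsto_prod gauss_product qp
        LIMSEQ_subseq_LIMSEQ[OF gauss_product sub, unfolded o_def] zq)
  have lim2: "(\<lambda>n. gauss_prod ((- q) ^ p) (p * n) * gauss_prod ((- q) ^ p) n ^ p)
      \<longlonglongrightarrow> ramanujan_phi (- ((- q) ^ p)) * ramanujan_phi (- ((- q) ^ p)) ^ p"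
    by (intro tendsto_mult tendsto_power gauss_product qp
        LIMSEQ_subseq_LIMSEQ[OF gauss_product sub, unfolded o_def])
  show ?thesis
    using LIMSEQ_unique[OF lim1[unfolded gauss_prod_unity_roots[OF p]] lim2]
    by (simp only: odd_p mult_minus_right minus_minus power_Suc)
qed

section \<open>Residue classes and sublattices of the Gaussian integers\<close>

definition theta_part :: "'a::{real_normed_field, banach} \<Rightarrow> int \<Rightarrow> int \<Rightarrow> 'a" where
  "theta_part q N r = (\<Sum>\<^sub>\<infinity>n\<in>{n. n mod N = r}. q powi (n\<^sup>2))"

lemma phi_abs_summable:
  fixes q :: "'a::{real_normed_field, banach}"
  assumes "norm q < 1"
  shows "(\<lambda>n::int. norm (q powi (n\<^sup>2))) summable_on A"
proof -
  have "(\<lambda>n::int. norm q powi (n\<^sup>2)) summable_on UNIV"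
    using has_sum_ramanujan_phi[of "norm q"] assms by (auto simp: summable_on_def)
  then have "(\<lambda>n::int. norm q powi (n\<^sup>2)) summable_on A"
    by (rule summable_on_subset_banach) simp
  then show ?thesis by (simp add: norm_power_int)
qed

lemma phi_summable:
  fixes q :: "'a::{real_normed_field, banach}"
  shows "norm q < 1 \<Longrightarrow> (\<lambda>n::int. q powi (n\<^sup>2)) summable_on A"
  by (rule abs_summable_summable) (rule phi_abs_summable)

text \<open>
In the class of \<open>r\<close> the exponent \<open>n^2\<close> is congruent to \<open>r^2\<close>, so \<open>z\<close> contributes the
  constant \<open>z^(r^2)\<close>.
\<close>
lemma phi_dissection:
  fixes q z :: "'a::{real_normed_field, banach}"
  assumes q: "norm q < 1" and N: "N > 0" and z: "z ^ N = 1"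
  shows "ramanujan_phi (z * q) = (\<Sum>r<N. z ^ (r\<^sup>2) * theta_part q (int N) (int r))"
proof -
  have z0: "norm z = 1"
    using z N power_eq_1_iff[of z N] by auto
  let ?C = "\<lambda>r::nat. {n. n mod int N = int r}"
  have C: "(\<Union>r\<in>{..<N}. ?C r) = UNIV"
  proof -
    have "n \<in> ?C (nat (n mod int N))" "nat (n mod int N) < N" for n
      using N by (simp_all add: nat_less_iff)
    then show ?thesis by blast
  qed
  have powz: "z powi (n\<^sup>2) = z ^ (r\<^sup>2)" if "n \<in> ?C r" for n r
  proof -
    have "n\<^sup>2 mod int N = int (r\<^sup>2) mod int N"
      using that power_mod[of n "int N" 2] by simp
    then obtain t where t: "n\<^sup>2 = int (r\<^sup>2) + int N * t"
      by (metis mod_eqE)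
    have "z \<noteq> 0" using z0 by auto
    then show ?thesis
      unfolding t by (simp add: power_int_add power_int_mult z flip: of_nat_power)
  qed
  have "ramanujan_phi (z * q) = (\<Sum>\<^sub>\<infinity>n\<in>(\<Union>r\<in>{..<N}. ?C r). (z * q) powi (n\<^sup>2))"
    by (simp add: C ramanujan_phi_def)
  also have "\<dots> = (\<Sum>r<N. \<Sum>\<^sub>\<infinity>n\<in>?C r. (z * q) powi (n\<^sup>2))"
    using q z0 by (intro sum_infsum[symmetric]) (auto intro!: phi_summable simp: norm_mult)
  also have "\<dots> = (\<Sum>r<N. \<Sum>\<^sub>\<infinity>n\<in>?C r. z ^ (r\<^sup>2) * q powi (n\<^sup>2))"
    by (intro sum.cong infsum_cong) (simp_all add: power_int_mult_distrib powz)
  also have "\<dots> = (\<Sum>r<N. z ^ (r\<^sup>2) * theta_part q (int N) (int r))"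
    by (simp add: theta_part_def infsum_cmult_right')
  finally show ?thesis .
qed

lemma theta_part_0: 
  fixes q :: "'a::{real_normed_field, banach}"
  assumes "N > 0" shows "theta_part q (int N) 0 = ramanujan_phi (q ^ N\<^sup>2)"
proof -
  have "bij_betw (\<lambda>m. int N * m) UNIV {n. n mod int N = 0}"
    using assms by (intro bij_betwI[where g = "\<lambda>n. n div int N"]) auto
  then have "theta_part q (int N) 0 = (\<Sum>\<^sub>\<infinity>m. q powi ((int N * m)\<^sup>2))"
    unfolding theta_part_def by (rule infsum_reindex_bij_betw[symmetric])
  then show ?thesis
    by (simp add: ramanujan_phi_def power_mult_distrib power_int_mult flip: of_nat_power)
qed

lemma theta_part_reflect:
  assumes "0 < r" "r < N"
  shows "theta_part q N (N - r) = theta_part q N r"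
proof -
  have "bij_betw uminus {n. n mod N = r} {n. n mod N = N - r}"
    using assms by (intro bij_betwI[where g = uminus]) (auto simp: zmod_zminus1_eq_if)
  then have "theta_part q N (N - r) = (\<Sum>\<^sub>\<infinity>n\<in>{n. n mod N = r}. q powi ((- n)\<^sup>2))"
    unfolding theta_part_def by (rule infsum_reindex_bij_betw[symmetric])
  then show ?thesis by (simp add: theta_part_def)
qed

lemma infsum_times:
  fixes f :: "'a \<Rightarrow> 'c::{real_normed_field, banach}" and g :: "'b \<Rightarrow> 'c"
  assumes f: "(\<lambda>x. norm (f x)) summable_on A" and g: "(\<lambda>y. norm (g y)) summable_on B"
  shows "(\<lambda>(x, y). norm (f x * g y)) summable_on A \<times> B"
    and "(\<Sum>\<^sub>\<infinity>(x, y)\<in>A \<times> B. f x * g y) = (\<Sum>\<^sub>\<infinity>x\<in>A. f x) * (\<Sum>\<^sub>\<infinity>y\<in>B. g y)"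
proof -
  have *: "(\<lambda>z. norm (f (fst z) * g (snd z))) summable_on A \<times> B"
    unfolding Infinite_Sum.abs_summable_on_Sigma_iff using f g
    by (auto simp: norm_mult infsum_cmult_right' abs_mult intro!: summable_on_cmult_right summable_on_cmult_left)
  then show "(\<lambda>(x, y). norm (f x * g y)) summable_on A \<times> B"
    by (simp add: case_prod_unfold)
  have "(\<Sum>\<^sub>\<infinity>(x, y)\<in>A \<times> B. f x * g y) = (\<Sum>\<^sub>\<infinity>x\<in>A. \<Sum>\<^sub>\<infinity>y\<in>B. f x * g y)"
    using infsum_Sigma_banach[OF abs_summable_summable[OF *]] by (simp add: case_prod_unfold)
  then show "(\<Sum>\<^sub>\<infinity>(x, y)\<in>A \<times> B. f x * g y) = (\<Sum>\<^sub>\<infinity>x\<in>A. f x) * (\<Sum>\<^sub>\<infinity>y\<in>B. g y)"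
    by (simp add: infsum_cmult_right' infsum_cmult_left')
qed

text \<open>
Multiplication by \<open>\<alpha> + \<beta> i\<close> maps the Gaussian integers onto the ideal it generates and multiplies norms by
  \<open>N\<close>. So \<open>\<phi>(q^N)^2\<close> is the sum of \<open>q^(a^2 + b^2)\<close> over that ideal, and as the ideal contains
  \<open>N\<close>, it is a union of products of residue classes mod \<open>N\<close>.
\<close>
proposition phi_square_sublattice:
  fixes q :: "'a::{real_normed_field, banach}" and \<alpha> \<beta> :: int
  assumes q: "norm q < 1" and N: "N > 0" "\<alpha>\<^sup>2 + \<beta>\<^sup>2 = int N"
  shows "(ramanujan_phi (q ^ N))\<^sup>2 =
    (\<Sum>(r, s) | r \<in> {0..<int N} \<and> s \<in> {0..<int N} \<and> int N dvd \<alpha> * r + \<beta> * s \<and> int N dvd \<alpha> * s - \<beta> * r.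
       theta_part q (int N) r * theta_part q (int N) s)"
    (is "_ = sum _ ?L0")
proof -
  define f :: "int \<times> int \<Rightarrow> 'a" where "f = (\<lambda>(a, b). q powi (a\<^sup>2) * q powi (b\<^sup>2))"
  define L where "L = {(a, b). int N dvd \<alpha> * a + \<beta> * b \<and> int N dvd \<alpha> * b - \<beta> * a}"
  define C where "C = (\<lambda>(r, s). {a. a mod int N = r} \<times> {b. b mod int N = s})"
  have f_powi: "f (a, b) = q powi (a\<^sup>2 + b\<^sup>2)" for a b
    by (cases "a = 0 \<and> b = 0") (auto simp: f_def power_int_add)
  have sum_f: "f summable_on A \<times> B" for A B
  proof (rule abs_summable_summable)
    show "(\<lambda>z. norm (f z)) summable_on A \<times> B"
      using infsum_times(1)[OF phi_abs_summable phi_abs_summable, OF q q, of A B]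
      by (simp add: f_def case_prod_unfold)
  qed
  have bij: "bij_betw (\<lambda>(x, y). (\<alpha> * x - \<beta> * y, \<beta> * x + \<alpha> * y)) (UNIV \<times> UNIV) L"
  proof (rule bij_betwI[where g = "\<lambda>(a, b). ((\<alpha> * a + \<beta> * b) div int N, (\<alpha> * b - \<beta> * a) div int N)"])
    have norm1: "\<alpha> * (\<alpha> * x - \<beta> * y) + \<beta> * (\<beta> * x + \<alpha> * y) = int N * x"
      and norm2: "\<alpha> * (\<beta> * x + \<alpha> * y) - \<beta> * (\<alpha> * x - \<beta> * y) = int N * y" for x y
      unfolding N(2)[symmetric] by (simp_all add: algebra_simps power2_eq_square)
    show "(\<lambda>(x, y). (\<alpha> * x - \<beta> * y, \<beta> * x + \<alpha> * y)) \<in> UNIV \<times> UNIV \<rightarrow> L"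
      by (auto simp: L_def norm1 norm2)
    show "(case case xy of (x, y) \<Rightarrow> (\<alpha> * x - \<beta> * y, \<beta> * x + \<alpha> * y) of
        (a, b) \<Rightarrow> ((\<alpha> * a + \<beta> * b) div int N, (\<alpha> * b - \<beta> * a) div int N)) = xy" for xy
      using N by (cases xy) (simp add: norm1 norm2)
    show "(case case ab of (a, b) \<Rightarrow> ((\<alpha> * a + \<beta> * b) div int N, (\<alpha> * b - \<beta> * a) div int N) of
        (x, y) \<Rightarrow> (\<alpha> * x - \<beta> * y, \<beta> * x + \<alpha> * y)) = ab" if "ab \<in> L" for ab
    proof (cases ab)
      case (Pair a b)
      with that obtain x y where xy: "\<alpha> * a + \<beta> * b = int N * x" "\<alpha> * b - \<beta> * a = int N * y"
        by (auto simp: L_def elim!: dvdE)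
      have "int N * (\<alpha> * x - \<beta> * y) = int N * a" "int N * (\<beta> * x + \<alpha> * y) = int N * b"
      proof -
        have "(\<alpha>\<^sup>2 + \<beta>\<^sup>2) * a = \<alpha> * (\<alpha> * a + \<beta> * b) - \<beta> * (\<alpha> * b - \<beta> * a)"
          "(\<alpha>\<^sup>2 + \<beta>\<^sup>2) * b = \<beta> * (\<alpha> * a + \<beta> * b) + \<alpha> * (\<alpha> * b - \<beta> * a)"
          by (simp_all add: algebra_simps power2_eq_square)
        moreover have "int N * (\<alpha> * x - \<beta> * y) = \<alpha> * (int N * x) - \<beta> * (int N * y)"
          "int N * (\<beta> * x + \<alpha> * y) = \<beta> * (int N * x) + \<alpha> * (int N * y)"
          by (simp_all add: algebra_simps)
        ultimately show "int N * (\<alpha> * x - \<beta> * y) = int N * a" "int N * (\<beta> * x + \<alpha> * y) = int N * b"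
          by (simp_all only: N(2) xy)
      qed
      then show ?thesis using N Pair xy by simp
    qed
  qed auto
  have "(ramanujan_phi (q ^ N))\<^sup>2 = (\<Sum>\<^sub>\<infinity>(x, y)\<in>UNIV \<times> UNIV. (q ^ N) powi (x\<^sup>2) * (q ^ N) powi (y\<^sup>2))"
  proof -
    have "norm (q ^ N) < 1" using q N by (simp add: norm_power power_less_one_iff)
    then show ?thesis
      unfolding ramanujan_phi_def power2_eq_square[of "infsum _ _"]
      by (intro infsum_times(2)[symmetric] phi_abs_summable)
  qed
  also have "\<dots> = (\<Sum>\<^sub>\<infinity>(x, y)\<in>UNIV \<times> UNIV. f (\<alpha> * x - \<beta> * y, \<beta> * x + \<alpha> * y))"
  proof (intro infsum_cong, clarify)
    fix x y :: int
    have "(\<alpha> * x - \<beta> * y)\<^sup>2 + (\<beta> * x + \<alpha> * y)\<^sup>2 = int N * x\<^sup>2 + int N * y\<^sup>2"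
      unfolding N(2)[symmetric] by (simp add: algebra_simps power2_eq_square)
    moreover have "q powi (int N * x\<^sup>2 + int N * y\<^sup>2) = q powi (int N * x\<^sup>2) * q powi (int N * y\<^sup>2)"
    proof (cases "x = 0 \<and> y = 0")
      case False
      then have "int N * x\<^sup>2 + int N * y\<^sup>2 \<noteq> 0"
        using N(1) by (simp add: add_nonneg_eq_0_iff)
      then show ?thesis by (intro power_int_add) auto
    qed auto
    ultimately show "(q ^ N) powi x\<^sup>2 * (q ^ N) powi y\<^sup>2 = f (\<alpha> * x - \<beta> * y, \<beta> * x + \<alpha> * y)"
      by (simp add: f_powi power_int_mult)
  qed
  also have "\<dots> = infsum f L"
    using infsum_reindex_bij_betw[OF bij, of f] by (simp add: case_prod_unfold)
  also have "L = (\<Union>c\<in>?L0. C c)"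
  proof -
    have "int N dvd \<alpha> * a + \<beta> * b \<longleftrightarrow> int N dvd \<alpha> * (a mod int N) + \<beta> * (b mod int N)"
      "int N dvd \<alpha> * b - \<beta> * a \<longleftrightarrow> int N dvd \<alpha> * (b mod int N) - \<beta> * (a mod int N)" for a b
    proof -
      have "int N dvd a - a mod int N" "int N dvd b - b mod int N"
        by simp_all
      then have "int N dvd \<alpha> * (a - a mod int N) + \<beta> * (b - b mod int N)"
        "int N dvd \<alpha> * (b - b mod int N) - \<beta> * (a - a mod int N)"
        by (meson dvd_add dvd_diff dvd_mult)+
      then have "int N dvd (\<alpha> * a + \<beta> * b) - (\<alpha> * (a mod int N) + \<beta> * (b mod int N))"
        "int N dvd (\<alpha> * b - \<beta> * a) - (\<alpha> * (b mod int N) - \<beta> * (a mod int N))"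
        by (simp_all add: algebra_simps)
      then show "int N dvd \<alpha> * a + \<beta> * b \<longleftrightarrow> int N dvd \<alpha> * (a mod int N) + \<beta> * (b mod int N)"
        "int N dvd \<alpha> * b - \<beta> * a \<longleftrightarrow> int N dvd \<alpha> * (b mod int N) - \<beta> * (a mod int N)"
        by (metis diff_add_cancel dvd_add_right_iff)+
    qed
    then show ?thesis
      using N by (auto simp: L_def C_def)
  qed
  also have "infsum f (\<Union>c\<in>?L0. C c) = (\<Sum>c\<in>?L0. infsum f (C c))"
  proof (rule sum_infsum[symmetric])
    show "finite ?L0"
      by (rule finite_subset[of _ "{0..<int N} \<times> {0..<int N}"]) auto
    show "f summable_on C c" for c
      unfolding C_def by (cases c) (auto intro!: sum_f)
  qed (auto simp: C_def)
  also have "\<dots> = (\<Sum>(r, s)\<in>?L0. theta_part q (int N) r * theta_part q (int N) s)"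
    using q by (intro sum.cong refl) (auto simp: C_def f_def theta_part_def infsum_times(2) phi_abs_summable)
  finally show ?thesis .
qed

section \<open>Phi along the arithmetic-geometric mean\<close>

text \<open>
The case \<open>1 + i\<close> of the sublattice formula: the ideal consists of the pairs of equal parity.
\<close>
lemma phi_square_double:
  fixes q :: real
  assumes q: "norm q < 1"
  shows "(ramanujan_phi q)\<^sup>2 + (ramanujan_phi (- q))\<^sup>2 = 2 * (ramanujan_phi (q\<^sup>2))\<^sup>2"
proof -
  let ?A = "theta_part q (int 2) 0" and ?B = "theta_part q (int 2) 1"
  have plus: "ramanujan_phi q = ?A + ?B"
    using phi_dissection[OF q, of 2 1] by (simp add: lessThan_nat_numeral)
  have minus: "ramanujan_phi (- q) = ?A - ?B"
    using phi_dissection[OF q, of 2 "- 1"] by (simp add: lessThan_nat_numeral)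
  have square: "(ramanujan_phi (q\<^sup>2))\<^sup>2 = ?A\<^sup>2 + ?B\<^sup>2"
  proof -
    have "{(r, s). r \<in> {0..<int 2} \<and> s \<in> {0..<int 2} \<and> int 2 dvd 1 * r + 1 * s \<and> int 2 dvd 1 * s - 1 * r}
        = {(0, 0), (1, 1)}"
      by (auto; presburger)
    then show ?thesis
      using phi_square_sublattice[OF q, of 2 1 1] by (simp add: power2_eq_square)
  qed
  show ?thesis
    unfolding plus minus square by (simp add: power2_eq_square algebra_simps)
qed

lemma phi_summable_nat:
  fixes q :: real
  assumes "norm q < 1"
  shows "summable (\<lambda>n. q ^ ((Suc n)\<^sup>2))"
proof (rule summable_comparison_test')
  show "summable (\<lambda>n. norm q ^ n)" using assms by (simp add: summable_geometric)
  show "norm (q ^ ((Suc n)\<^sup>2)) \<le> norm q ^ n" for n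
    unfolding norm_power using assms by (intro power_decreasing) (auto simp: power2_eq_square)
qed

lemma phi_ge_1: "0 \<le> q \<Longrightarrow> q < 1 \<Longrightarrow> ramanujan_phi (q::real) \<ge> 1"
  using suminf_nonneg[OF phi_summable_nat[of q]] by (simp add: ramanujan_phi_eq)

lemma phi_near_1:
  fixes q :: real
  assumes q: "\<bar>q\<bar> < 1"
  shows "\<bar>ramanujan_phi q - 1\<bar> \<le> 2 * \<bar>q\<bar> / (1 - \<bar>q\<bar>)"
proof -
  have "norm (\<Sum>n. q ^ ((Suc n)\<^sup>2)) \<le> (\<Sum>n. \<bar>q\<bar> * \<bar>q\<bar> ^ n)"
  proof (rule norm_suminf_le)
    show "norm (q ^ ((Suc n)\<^sup>2)) \<le> \<bar>q\<bar> * \<bar>q\<bar> ^ n" for n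
      unfolding real_norm_def power_abs power_Suc[symmetric]
      using q by (intro power_decreasing) (auto simp: power2_eq_square)
    show "summable (\<lambda>n. \<bar>q\<bar> * \<bar>q\<bar> ^ n)" using q by (intro summable_mult summable_geometric) simp
  qed
  also have "\<dots> = \<bar>q\<bar> / (1 - \<bar>q\<bar>)"
    using q suminf_mult[of "\<lambda>n. \<bar>q\<bar> ^ n" "\<bar>q\<bar>"] by (simp add: summable_geometric suminf_geometric)
  finally show ?thesis using q by (simp add: ramanujan_phi_eq)
qed

text \<open>
The difference is \<open>4 (q + q^9 + ...)\<close>; its leading term fixes the rate at which \<open>phi_c\<close> vanishes.
\<close>
lemma phi_minus_phi_bounds:
  fixes q :: real
  assumes q: "0 < q" "q < 1"
  shows "4 * q \<le> ramanujan_phi q - ramanujan_phi (- q)"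
    and "ramanujan_phi q - ramanujan_phi (- q) \<le> 4 * q / (1 - q)"
proof -
  let ?f = "\<lambda>n. q ^ ((Suc n)\<^sup>2) - (- q) ^ ((Suc n)\<^sup>2)"
  have sum: "summable ?f" using q by (intro summable_diff phi_summable_nat) auto
  have eq: "ramanujan_phi q - ramanujan_phi (- q) = 2 * suminf ?f"
    using q suminf_diff[OF phi_summable_nat[of q] phi_summable_nat[of "- q"]]
    by (simp add: ramanujan_phi_eq)
  have abs_le: "\<bar>(- q) ^ m\<bar> \<le> q ^ m" for m using q by (simp add: power_abs)
  have nonneg: "0 \<le> ?f n" for n using abs_le_D1[OF abs_le[of "(Suc n)\<^sup>2"]] by (simp only: diff_ge_0_iff_ge)
  have "sum ?f {0} \<le> suminf ?f" by (rule sum_le_suminf[OF sum]) (use nonneg in auto)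
  then show "4 * q \<le> ramanujan_phi q - ramanujan_phi (- q)" unfolding eq by simp
  have "suminf ?f \<le> (\<Sum>n. 2 * q * q ^ n)"
  proof (rule suminf_le[OF _ sum])
    show "?f n \<le> 2 * q * q ^ n" for n
    proof -
      have "q ^ ((Suc n)\<^sup>2) \<le> q * q ^ n"
        unfolding power_Suc[symmetric] using q by (intro power_decreasing) (auto simp: power2_eq_square)
      then show ?thesis using abs_le_D2[OF abs_le[of "(Suc n)\<^sup>2"]] by linarith
    qed
    show "summable (\<lambda>n. 2 * q * q ^ n)" using q by (intro summable_mult summable_geometric) simp
  qed
  also have "\<dots> = 2 * q / (1 - q)"
    using q suminf_mult[of "\<lambda>n. q ^ n" "2 * q"] by (simp add: summable_geometric suminf_geometric)
  finally show "ramanujan_phi q - ramanujan_phi (- q) \<le> 4 * q / (1 - q)" unfolding eq by simp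
qed

definition phi_a :: "real \<Rightarrow> real" where "phi_a q = (ramanujan_phi q)\<^sup>2"
definition phi_b :: "real \<Rightarrow> real" where "phi_b q = (ramanujan_phi (- q))\<^sup>2"
text \<open>
This is \<open>\<theta>\<^sub>2(q)^2\<close> by Jacobi's identity \<open>\<theta>\<^sub>3^4 = \<theta>\<^sub>2^4 + \<theta>\<^sub>4^4\<close>. Defining it by that
  identity makes its behaviour under \<open>q \<mapsto> q^2\<close> a matter of algebra.
\<close>
definition phi_c :: "real \<Rightarrow> real" where "phi_c q = sqrt ((phi_a q)\<^sup>2 - (phi_b q)\<^sup>2)"

lemma iterated_square_tendsto_0:
  assumes "0 < (q::real)" "q < 1"
  shows "(\<lambda>n. q ^ (2 ^ n)) \<longlonglongrightarrow> 0"
proof -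
  have "strict_mono (\<lambda>n. 2 ^ n :: nat)" by (simp add: strict_mono_def)
  from LIMSEQ_subseq_LIMSEQ[OF LIMSEQ_realpow_zero this] assms show ?thesis by (simp add: o_def)
qed

lemma phi_tendsto_1:
  assumes x: "x \<longlonglongrightarrow> (0::real)"
  shows "(\<lambda>n. ramanujan_phi (x n)) \<longlonglongrightarrow> 1"
proof -
  have "(\<lambda>n. ramanujan_phi (x n) - 1) \<longlonglongrightarrow> 0"
  proof (rule Lim_null_comparison)
    have "eventually (\<lambda>n. \<bar>x n\<bar> < 1) sequentially"
      using x by (simp add: tendsto_iff dist_real_def)
    then show "eventually (\<lambda>n. norm (ramanujan_phi (x n) - 1) \<le> 2 * \<bar>x n\<bar> / (1 - \<bar>x n\<bar>)) sequentially"
      by eventually_elim (use phi_near_1 in auto)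
    have "(\<lambda>n. 2 * \<bar>x n\<bar> / (1 - \<bar>x n\<bar>)) \<longlonglongrightarrow> 2 * \<bar>0\<bar> / (1 - \<bar>0\<bar>)"
      by (intro tendsto_intros x) auto
    then show "(\<lambda>n. 2 * \<bar>x n\<bar> / (1 - \<bar>x n\<bar>)) \<longlonglongrightarrow> 0" by simp
  qed
  then show ?thesis by (simp add: LIM_zero_iff)
qed

text \<open>
Positivity is clear close to \<open>q = 0\<close>, and \<open>\<phi>(q) \<phi>(-q) = \<phi>(-q^2)^2\<close> carries it from \<open>q^2\<close> to \<open>q\<close>.
\<close>
lemma phi_minus_pos:
  fixes q :: real
  assumes "0 < q" "q < 1"
  shows "ramanujan_phi (- q) > 0"
proof -
  have "(\<lambda>n. ramanujan_phi (- (q ^ (2 ^ n)))) \<longlonglongrightarrow> 1"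
    using tendsto_minus[OF iterated_square_tendsto_0[OF assms]] by (intro phi_tendsto_1) simp
  then have "eventually (\<lambda>n. ramanujan_phi (- (q ^ (2 ^ n))) > 0) sequentially"
    by (rule order_tendstoD) simp
  then obtain n where "ramanujan_phi (- (q ^ (2 ^ n))) > 0"
    by (auto simp: eventually_sequentially)
  then show ?thesis
    using assms
  proof (induction n arbitrary: q)
    case (Suc n)
    have "(q\<^sup>2) ^ (2 ^ n) = q ^ (2 ^ Suc n)"
      by (simp only: power_Suc power_mult)
    then have "ramanujan_phi (- ((q\<^sup>2) ^ (2 ^ n))) > 0"
      using Suc.prems(1) by (simp only:)
    moreover have "0 < q\<^sup>2" "q\<^sup>2 < 1"
      using Suc.prems(2,3) by (auto simp: abs_square_less_1)
    ultimately have "ramanujan_phi (- (q\<^sup>2)) > 0"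
      by (rule Suc.IH)
    then have "ramanujan_phi q * ramanujan_phi (- q) > 0"
      using phi_mult_phi_minus[of q] Suc.prems(2,3) by simp
    then show ?case
      using phi_ge_1[of q] Suc.prems(2,3) by (simp add: zero_less_mult_iff)
  qed simp
qed

lemma phi_less:
  assumes q: "0 < q" "q < 1"
  shows "0 < phi_b q" "phi_b q < phi_a q" "0 < phi_c q" "phi_c q < phi_a q"
proof -
  have "0 < ramanujan_phi (- q)" "ramanujan_phi (- q) < ramanujan_phi q"
    using q phi_minus_pos[OF q] phi_minus_phi_bounds(1)[OF q] by auto
  then show ab: "0 < phi_b q" "phi_b q < phi_a q"
    unfolding phi_a_def phi_b_def by (auto intro!: power_strict_mono)
  then show "0 < phi_c q"
    unfolding phi_c_def by (simp add: power_strict_mono)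
  have "phi_c q < sqrt ((phi_a q)\<^sup>2)"
    unfolding phi_c_def using ab by (intro real_sqrt_less_mono) simp
  then show "phi_c q < phi_a q" using ab by simp
qed

lemma phi_pythagoras:
  assumes q: "0 < q" "q < 1"
  shows "(phi_b q)\<^sup>2 + (phi_c q)\<^sup>2 = (phi_a q)\<^sup>2"
  using phi_less[OF q] by (simp add: phi_c_def power_mono)

lemma phi_agm_step:
  assumes q: "0 < q" "q < 1"
  shows "phi_a (q\<^sup>2) = (phi_a q + phi_b q) / 2"
    and "phi_b (q\<^sup>2) = sqrt (phi_a q * phi_b q)"
    and "phi_c (q\<^sup>2) = (phi_a q - phi_b q) / 2"
proof -
  show a: "phi_a (q\<^sup>2) = (phi_a q + phi_b q) / 2"
    using phi_square_double[of q] q by (simp add: phi_a_def phi_b_def)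
  have "phi_b (q\<^sup>2) = ramanujan_phi q * ramanujan_phi (- q)"
    using phi_mult_phi_minus[of q] q by (simp add: phi_b_def)
  also have "\<dots> = sqrt ((ramanujan_phi q * ramanujan_phi (- q))\<^sup>2)"
    using phi_minus_pos[OF q] phi_ge_1[of q] q by (intro real_sqrt_unique[symmetric]) auto
  finally show b: "phi_b (q\<^sup>2) = sqrt (phi_a q * phi_b q)"
    by (simp add: phi_a_def phi_b_def power_mult_distrib)
  have "(phi_a (q\<^sup>2))\<^sup>2 - (phi_b (q\<^sup>2))\<^sup>2 = ((phi_a q - phi_b q) / 2)\<^sup>2"
    unfolding a b using phi_less[OF q] by (simp add: power2_eq_square field_simps)
  then show "phi_c (q\<^sup>2) = (phi_a q - phi_b q) / 2"
    unfolding phi_c_def using phi_less[OF q] by simp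
qed

lemma square_bounds: "0 < (x::real) \<Longrightarrow> x < 1 \<Longrightarrow> 0 < x\<^sup>2" "0 < (x::real) \<Longrightarrow> x < 1 \<Longrightarrow> x\<^sup>2 < 1"
  by (auto simp: abs_square_less_1)

lemma iterated_square_bounds:
  "0 < (q::real) \<Longrightarrow> q < 1 \<Longrightarrow> 0 < q ^ (2 ^ n)" "0 < (q::real) \<Longrightarrow> q < 1 \<Longrightarrow> q ^ (2 ^ n) < 1"
  by (simp_all add: power_less_one_iff)

lemma agm_phi_ab_iterate:
  assumes "0 < q" "q < 1"
  shows "agm_integral (phi_a q) (phi_b q) = agm_integral (phi_a (q ^ (2 ^ n))) (phi_b (q ^ (2 ^ n)))"
proof (induction n)
  case (Suc n)
  let ?x = "q ^ (2 ^ n)"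
  have x: "0 < ?x" "?x < 1" using iterated_square_bounds[OF assms] by auto
  have "agm_integral (phi_a (?x\<^sup>2)) (phi_b (?x\<^sup>2)) = agm_integral (phi_a ?x) (phi_b ?x)"
    unfolding phi_agm_step[OF x] using phi_less[OF x] by (intro agm_integral_step) auto
  moreover have "?x\<^sup>2 = q ^ (2 ^ Suc n)" by (simp add: mult.commute flip: power_mult)
  ultimately show ?case using Suc by simp
qed simp

text \<open>
With \<open>a'\<close> and \<open>c'\<close> the values at \<open>x^2\<close>, those at \<open>x\<close> are \<open>a' + c'\<close> and \<open>2 sqrt (a' c')\<close>, which is
  twice a step of the mean applied to \<open>(a', c')\<close>.
\<close>
lemma agm_phi_ac_iterate:
  assumes "0 < q" "q < 1"
  shows "agm_integral (phi_a q) (phi_c q) = agm_integral (phi_a (q ^ (2 ^ n))) (phi_c (q ^ (2 ^ n))) / 2 ^ n"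
proof (induction n)
  case (Suc n)
  let ?x = "q ^ (2 ^ n)"
  have x: "0 < ?x" "?x < 1" using iterated_square_bounds[OF assms] by auto
  note x2 = square_bounds[OF x]
  let ?a = "phi_a (?x\<^sup>2)" and ?c = "phi_c (?x\<^sup>2)"
  have pos: "?a > 0" "?c > 0" using phi_less[OF x2] by auto
  have "phi_a ?x = 2 * ((?a + ?c) / 2)"
    by (simp add: phi_agm_step[OF x] field_simps)
  moreover have "phi_c ?x = 2 * sqrt (?a * ?c)"
  proof -
    have "(phi_a ?x)\<^sup>2 - (phi_b ?x)\<^sup>2 = 2\<^sup>2 * (?a * ?c)"
      unfolding phi_agm_step[OF x] by (simp add: power2_eq_square field_simps)
    then show ?thesis
      unfolding phi_c_def[of ?x] by (simp only: real_sqrt_mult) simp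
  qed
  ultimately have "agm_integral (phi_a ?x) (phi_c ?x) = agm_integral ((?a + ?c) / 2) (sqrt (?a * ?c)) / 2"
    by (simp only: agm_integral_scale[of 2])
  also have "\<dots> = agm_integral ?a ?c / 2"
    using pos by (simp only: agm_integral_step)
  also have "?x\<^sup>2 = q ^ (2 ^ Suc n)" by (simp add: mult.commute flip: power_mult)
  finally have "agm_integral (phi_a ?x) (phi_c ?x)
      = agm_integral (phi_a (q ^ (2 ^ Suc n))) (phi_c (q ^ (2 ^ Suc n))) / 2" .
  then show ?case
    unfolding Suc by (simp only: divide_divide_eq_left power_Suc)
qed simp

lemma phi_ab_limits:
  assumes "0 < q" "q < 1"
  shows "(\<lambda>n. phi_a (q ^ (2 ^ n))) \<longlonglongrightarrow> 1" "(\<lambda>n. phi_b (q ^ (2 ^ n))) \<longlonglongrightarrow> 1"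
  using tendsto_power[OF phi_tendsto_1[OF iterated_square_tendsto_0[OF assms]], of 2]
    tendsto_power[OF phi_tendsto_1[OF tendsto_minus[OF iterated_square_tendsto_0[OF assms], simplified]], of 2]
  by (simp_all add: phi_a_def phi_b_def)

text \<open>
Both arguments tend to 1 along the iteration, which does not change the integral.
\<close>
proposition agm_phi_ab:
  assumes q: "0 < q" "q < 1"
  shows "agm_integral (phi_a q) (phi_b q) = pi"
proof (rule antisym)
  let ?a = "\<lambda>n. phi_a (q ^ (2 ^ n))" and ?b = "\<lambda>n. phi_b (q ^ (2 ^ n))"
  note x = iterated_square_bounds[OF q]
  have bounds: "pi / ?a n \<le> agm_integral (phi_a q) (phi_b q)"
      "agm_integral (phi_a q) (phi_b q) \<le> pi / ?b n" for n
    unfolding agm_phi_ab_iterate[OF q, of n] using phi_less[OF x, of n]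
    by (auto intro!: agm_integral_bounds)
  have "(\<lambda>n. pi / ?a n) \<longlonglongrightarrow> pi / 1" "(\<lambda>n. pi / ?b n) \<longlonglongrightarrow> pi / 1"
    by (intro tendsto_intros phi_ab_limits[OF q]; simp)+
  then have lims: "(\<lambda>n. pi / ?a n) \<longlonglongrightarrow> pi" "(\<lambda>n. pi / ?b n) \<longlonglongrightarrow> pi"
    by simp_all
  show "agm_integral (phi_a q) (phi_b q) \<le> pi"
    by (rule LIMSEQ_le_const[OF lims(2)]) (use bounds in blast)
  show "pi \<le> agm_integral (phi_a q) (phi_b q)"
    by (rule LIMSEQ_le_const2[OF lims(1)]) (use bounds in blast)
qed

text \<open>
The square of the modulus \<open>c/a\<close> behaves like \<open>16 q\<close>; here \<open>\<rho>\<close> tends to 4 as \<open>q\<close> tends to 0.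
\<close>
lemma phi_modulus_bounds:
  assumes q: "0 < q" "q < 1"
  defines "\<rho> \<equiv> (ramanujan_phi q + ramanujan_phi (- q)) * (phi_a q + phi_b q) / (phi_a q)\<^sup>2"
  shows "4 * q * \<rho> \<le> (phi_c q / phi_a q)\<^sup>2" "(phi_c q / phi_a q)\<^sup>2 \<le> 4 * q * (\<rho> / (1 - q))" "\<rho> > 0"
proof -
  have pos: "ramanujan_phi q + ramanujan_phi (- q) > 0" "phi_a q > 0" "phi_b q > 0"
    using phi_minus_pos[OF q] phi_ge_1[of q] phi_less[OF q] q by auto
  show \<rho>: "\<rho> > 0" using pos by (simp add: \<rho>_def)
  have "(phi_c q)\<^sup>2 = (phi_a q - phi_b q) * (phi_a q + phi_b q)"
    using phi_pythagoras[OF q] by (simp add: power2_eq_square algebra_simps)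
  also have "phi_a q - phi_b q = (ramanujan_phi q - ramanujan_phi (- q)) * (ramanujan_phi q + ramanujan_phi (- q))"
    by (simp add: phi_a_def phi_b_def power2_eq_square algebra_simps)
  finally have "(phi_c q / phi_a q)\<^sup>2 = (ramanujan_phi q - ramanujan_phi (- q)) * \<rho>"
    by (simp add: \<rho>_def power_divide)
  then show "4 * q * \<rho> \<le> (phi_c q / phi_a q)\<^sup>2" "(phi_c q / phi_a q)\<^sup>2 \<le> 4 * q * (\<rho> / (1 - q))"
    using mult_right_mono[OF phi_minus_phi_bounds(1)[OF q] less_imp_le[OF \<rho>]]
      mult_right_mono[OF phi_minus_phi_bounds(2)[OF q] less_imp_le[OF \<rho>]] by simp_all
qed

text \<open>
After \<open>n\<close> steps the modulus is about \<open>4 sqrt (q^(2^n))\<close>, so the integral there is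
  \<open>2^n ln (1/q)\<close> up to a bounded error, and the factor \<open>1/2^n\<close> removes the error in the limit.
\<close>
proposition agm_phi_ac:
  assumes q: "0 < q" "q < 1"
  shows "agm_integral (phi_a q) (phi_c q) = ln (1 / q)"
proof (rule antisym)
  define x where "x n = q ^ (2 ^ n)" for n
  have x: "0 < x n" "x n < 1" for n using iterated_square_bounds[OF q] by (simp_all add: x_def)
  have x0: "x \<longlonglongrightarrow> 0" unfolding x_def by (rule iterated_square_tendsto_0[OF q])
  define \<rho> where "\<rho> n = (ramanujan_phi (x n) + ramanujan_phi (- x n)) * (phi_a (x n) + phi_b (x n)) / (phi_a (x n))\<^sup>2" for n
  have lims: "(\<lambda>n. phi_a (x n)) \<longlonglongrightarrow> 1" "(\<lambda>n. phi_b (x n)) \<longlonglongrightarrow> 1"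
    unfolding x_def using phi_ab_limits[OF q] by simp_all
  have "\<rho> \<longlonglongrightarrow> (1 + 1) * (1 + 1) / 1\<^sup>2"
    unfolding \<rho>_def using tendsto_minus[OF x0]
    by (intro tendsto_intros lims phi_tendsto_1 x0) simp_all
  then have \<rho>: "\<rho> \<longlonglongrightarrow> 4" by simp
  define k where "k n = phi_c (x n) / phi_a (x n)" for n
  have k: "0 < k n" "k n \<le> 1" for n
    using phi_less[OF x, of n] by (auto simp: k_def)
  note mod = phi_modulus_bounds[OF x, folded \<rho>_def k_def]
  have lnx: "ln (1 / x n) = 2 ^ n * ln (1 / q)" for n
    using q by (simp add: x_def ln_div ln_realpow)
  have lnk: "2 * ln (1 / k n) = - ln ((k n)\<^sup>2)" for n
    using k[of n] by (simp add: ln_div ln_realpow)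
  \<comment> \<open>The logarithms of the bounds on the squared modulus differ from \<open>- 2^n ln (1/q)\<close> by convergent sequences.\<close>
  have lower: "2 * ln (1 / k n) \<ge> 2 ^ n * ln (1 / q) - ln (4 * (\<rho> n / (1 - x n)))" for n
  proof -
    have "ln ((k n)\<^sup>2) \<le> ln (x n * (4 * (\<rho> n / (1 - x n))))"
      using mod[of n] k[of n] x[of n] by (subst ln_le_cancel_iff) (auto simp: mult_ac)
    also have "\<dots> = - ln (1 / x n) + ln (4 * (\<rho> n / (1 - x n)))"
      using mod[of n] x[of n] by (subst ln_mult) (auto simp: ln_div)
    finally show ?thesis unfolding lnk lnx by simp
  qed
  have upper: "2 * ln (1 / k n) \<le> 2 ^ n * ln (1 / q) - ln (4 * \<rho> n)" for n
  proof -
    have "- ln (1 / x n) + ln (4 * \<rho> n) = ln (x n * (4 * \<rho> n))"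
      using mod[of n] x[of n] by (subst ln_mult) (auto simp: ln_div)
    also have "\<dots> \<le> ln ((k n)\<^sup>2)"
      using mod[of n] k[of n] x[of n] by (subst ln_le_cancel_iff) (auto simp: mult_ac)
    finally show ?thesis unfolding lnk lnx by simp
  qed
  have agm: "agm_integral (phi_a q) (phi_c q) = agm_integral 1 (k n) / phi_a (x n) / 2 ^ n" for n
  proof -
    have "agm_integral (phi_a (x n) * 1) (phi_a (x n) * k n) = agm_integral 1 (k n) / phi_a (x n)"
      using phi_less[OF x, of n] by (intro agm_integral_scale) simp
    moreover have "phi_a (x n) * k n = phi_c (x n)"
      using phi_less[OF x, of n] by (simp add: k_def)
    ultimately show ?thesis
      unfolding agm_phi_ac_iterate[OF q, of n, folded x_def] by simp
  qed
  have half: "(\<lambda>n. 1 / 2 ^ n :: real) \<longlonglongrightarrow> 0"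
    using LIMSEQ_realpow_zero[of "1/2"] by (simp add: power_one_over)
  have scaled: "(2 ^ n * l - c) / a / 2 ^ n = (l - c * (1 / 2 ^ n)) / a" for n :: nat and l c a :: real
    by (cases "a = 0") (simp_all add: field_simps)
  have pos: "phi_a (x n) > 0" for n using phi_less[OF x, of n] by simp
  have below: "(ln (1 / q) - ln (4 * (\<rho> n / (1 - x n))) * (1 / 2 ^ n)) / phi_a (x n) \<le> agm_integral (phi_a q) (phi_c q)" for n
    unfolding agm[of n] scaled[symmetric] using lower[of n] agm_integral_log_bounds[OF k, of n] pos[of n]
    by (intro divide_right_mono) auto
  have "(\<lambda>n. (ln (1 / q) - ln (4 * (\<rho> n / (1 - x n))) * (1 / 2 ^ n)) / phi_a (x n))
      \<longlonglongrightarrow> (ln (1 / q) - ln (4 * (4 / (1 - 0))) * 0) / 1"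
    by (intro tendsto_intros \<rho> x0 lims half) auto
  then have "(\<lambda>n. (ln (1 / q) - ln (4 * (\<rho> n / (1 - x n))) * (1 / 2 ^ n)) / phi_a (x n)) \<longlonglongrightarrow> ln (1 / q)"
    by simp
  then show "ln (1 / q) \<le> agm_integral (phi_a q) (phi_c q)"
    by (rule LIMSEQ_le_const2) (use below in blast)
  have above: "agm_integral (phi_a q) (phi_c q) \<le> (ln (1 / q) - (ln (4 * \<rho> n) - 2 * pi) * (1 / 2 ^ n)) / phi_a (x n)" for n
    unfolding agm[of n] scaled[symmetric] using upper[of n] agm_integral_log_bounds[OF k, of n] pos[of n]
    by (intro divide_right_mono) auto
  have "(\<lambda>n. (ln (1 / q) - (ln (4 * \<rho> n) - 2 * pi) * (1 / 2 ^ n)) / phi_a (x n))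
      \<longlonglongrightarrow> (ln (1 / q) - (ln (4 * 4) - 2 * pi) * 0) / 1"
    by (intro tendsto_intros \<rho> x0 lims half) auto
  then have "(\<lambda>n. (ln (1 / q) - (ln (4 * \<rho> n) - 2 * pi) * (1 / 2 ^ n)) / phi_a (x n)) \<longlonglongrightarrow> ln (1 / q)"
    by simp
  then show "agm_integral (phi_a q) (phi_c q) \<le> ln (1 / q)"
    by (rule LIMSEQ_le_const) (use above in blast)
qed

section \<open>Inversion and special values\<close>

lemma agm_integral_quotient:
  assumes "a > 0"
  shows "agm_integral 1 (b / a) = a * agm_integral a b"
  using agm_integral_scale[OF assms, of 1 "b / a"] assms by simp

lemma agm_integral_less_imp_less:
  assumes "a > 0" "b > 0" "b' > 0" "agm_integral a b < agm_integral a b'"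
  shows "b' < b"
  using agm_integral_antimono[of a a b b'] assms by force

text \<open>
The four integrals for the moduli \<open>b/a\<close> and \<open>c/a\<close> at \<open>q\<close> and at \<open>q'\<close> are known multiples of \<open>phi_a q\<close>
  and \<open>phi_a q'\<close>. If \<open>phi_a q'\<close> were too large, both moduli at \<open>q'\<close> would be smaller than the complementary
  ones at \<open>q\<close>, but the squares sum to 1 on either side.
\<close>
lemma phi_a_inversion_aux:
  assumes t: "t > 0"
  defines "q \<equiv> exp (- (pi * t))" and "q' \<equiv> exp (- (pi / t))"
  shows "phi_a q' \<le> t * phi_a q"
proof (rule ccontr)
  assume "\<not> phi_a q' \<le> t * phi_a q"
  then have less: "t * phi_a q < phi_a q'" by simp
  have q: "0 < q" "q < 1" and q': "0 < q'" "q' < 1" using t by (simp_all add: q_def q'_def)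
  note pos = phi_less[OF q] and pos' = phi_less[OF q']
  have a: "phi_a q > 0" "phi_a q' > 0" using pos pos' by auto
  have "ln (1 / q) = pi * t" "ln (1 / q') = pi / t" by (simp_all add: q_def q'_def ln_div)
  then have J: "agm_integral 1 (phi_b q / phi_a q) = phi_a q * pi"
      "agm_integral 1 (phi_c q / phi_a q) = phi_a q * (pi * t)"
      "agm_integral 1 (phi_b q' / phi_a q') = phi_a q' * pi"
      "agm_integral 1 (phi_c q' / phi_a q') = phi_a q' * (pi / t)"
    using a agm_phi_ab[OF q] agm_phi_ac[OF q] agm_phi_ab[OF q'] agm_phi_ac[OF q']
    by (simp_all add: agm_integral_quotient)
  have 1: "phi_c q' / phi_a q' < phi_b q / phi_a q"
    by (rule agm_integral_less_imp_less[of 1])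
       (use pos pos' a t less in \<open>simp_all add: J field_simps\<close>)
  have 2: "phi_b q' / phi_a q' < phi_c q / phi_a q"
    by (rule agm_integral_less_imp_less[of 1])
       (use pos pos' a t less in \<open>simp_all add: J field_simps\<close>)
  have "(phi_b q' / phi_a q')\<^sup>2 + (phi_c q' / phi_a q')\<^sup>2 < (phi_c q / phi_a q)\<^sup>2 + (phi_b q / phi_a q)\<^sup>2"
    using 1 2 pos pos' by (intro add_strict_mono power_strict_mono) auto
  moreover have "(phi_b q' / phi_a q')\<^sup>2 + (phi_c q' / phi_a q')\<^sup>2 = 1"
      "(phi_c q / phi_a q)\<^sup>2 + (phi_b q / phi_a q)\<^sup>2 = 1"
    using phi_pythagoras[OF q] phi_pythagoras[OF q'] a
    by (simp_all add: power_divide add.commute flip: add_divide_distrib)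
  ultimately show False by simp
qed

text \<open>
The auxiliary inequality for \<open>t\<close> and for \<open>1/t\<close> gives both directions.
\<close>
proposition phi_inversion:
  assumes t: "t > 0"
  shows "ramanujan_phi (exp (- (pi / t))) = sqrt t * ramanujan_phi (exp (- (pi * t)))"
proof -
  have "phi_a (exp (- (pi / t))) \<le> t * phi_a (exp (- (pi * t)))"
    by (rule phi_a_inversion_aux[OF t])
  moreover have "phi_a (exp (- (pi * t))) \<le> 1 / t * phi_a (exp (- (pi / t)))"
    using phi_a_inversion_aux[of "1 / t"] t by simp
  ultimately have "phi_a (exp (- (pi / t))) = t * phi_a (exp (- (pi * t)))"
    using t by (simp add: field_simps)
  then have "sqrt ((ramanujan_phi (exp (- (pi / t))))\<^sup>2) = sqrt (t * (ramanujan_phi (exp (- (pi * t))))\<^sup>2)"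
    by (simp add: phi_a_def)
  then show ?thesis
    using t phi_ge_1[of "exp (- (pi / t))"] phi_ge_1[of "exp (- (pi * t))"] by (simp add: real_sqrt_mult)
qed

text \<open>
Here \<open>ln (1/q) = \<pi>\<close>, so \<open>agm_phi_ab\<close> and \<open>agm_phi_ac\<close> give the same value and strict monotonicity forces
  \<open>phi_b = phi_c\<close>. The common integral is then lemniscatic, and reflection trades \<open>\<Gamma>(1/4)\<close> for \<open>\<Gamma>(3/4)\<close>.
\<close>
lemma phi_exp_minus_pi_aux:
  defines "q \<equiv> exp (- pi)"
  shows "phi_a q = sqrt 2 * phi_b q" "phi_a q = sqrt pi / (Gamma (3/4))\<^sup>2"
proof -
  have q: "0 < q" "q < 1" by (simp_all add: q_def)
  note pos = phi_less[OF q]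
  have "ln (1 / q) = pi" by (simp add: q_def ln_div)
  then have eq: "agm_integral (phi_a q) (phi_b q) = agm_integral (phi_a q) (phi_c q)"
    using agm_phi_ab[OF q] agm_phi_ac[OF q] by simp
  have bc: "phi_b q = phi_c q"
    using agm_integral_strict_antimono[of "phi_a q" "phi_b q" "phi_c q"]
      agm_integral_strict_antimono[of "phi_a q" "phi_c q" "phi_b q"] pos eq
    by (cases "phi_b q" "phi_c q" rule: linorder_cases) auto
  then have "(phi_a q)\<^sup>2 = 2 * (phi_b q)\<^sup>2" using phi_pythagoras[OF q] by simp
  then have "sqrt ((phi_a q)\<^sup>2) = sqrt (2 * (phi_b q)\<^sup>2)" by simp
  then show ab: "phi_a q = sqrt 2 * phi_b q" using pos by (simp add: real_sqrt_mult)
  have "pi = agm_integral (phi_b q * 1) (phi_b q * sqrt 2)"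
    using agm_phi_ab[OF q] agm_integral_commute unfolding ab by (simp add: mult.commute)
  also have "\<dots> = agm_integral 1 (sqrt 2) / phi_b q"
    using pos by (intro agm_integral_scale) simp
  also have "\<dots> = (sqrt pi * Gamma (1/4) / Gamma (3/4)) / (2 * phi_b q)"
    by (simp add: agm_integral_lemniscate Beta_def Gamma_one_half_real)
  also have "Gamma (1/4::real) = pi * sqrt 2 / Gamma (3/4)"
  proof -
    have "Gamma (complex_of_real (1/4)) * Gamma (1 - complex_of_real (1/4))
        = of_real pi / sin (of_real pi * of_real (1/4))"
      by (rule Gamma_reflection_complex)
    also have "1 - complex_of_real (1/4) = of_real (3/4)" by simp
    also have "of_real pi * complex_of_real (1/4) = of_real (pi / 4)" by simp
    finally have "complex_of_real (Gamma (1/4) * Gamma (3/4)) = of_real (pi / sin (pi / 4))"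
      by (simp only: Gamma_complex_of_real sin_of_real flip: of_real_mult of_real_divide)
    then have "Gamma (1/4) * Gamma (3/4) = pi / sin (pi / 4)"
      by (simp only: of_real_eq_iff)
    moreover have "Gamma (3/4::real) \<noteq> 0" using Gamma_real_pos[of "3/4"] by force
    moreover have "pi / sin (pi / 4) = pi * sqrt 2"
      by (simp add: sin_45 real_divide_square_eq field_simps)
    ultimately show ?thesis by (simp add: eq_divide_eq)
  qed
  also have "sqrt pi * (pi * sqrt 2 / Gamma (3/4)) / Gamma (3/4) / (2 * phi_b q)
      = pi * (sqrt pi / (Gamma (3/4))\<^sup>2 * (sqrt 2 / 2)) / phi_b q"
    by (simp add: power2_eq_square mult_ac)
  also have "sqrt 2 / 2 = 1 / sqrt (2::real)" by (simp add: field_simps)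
  finally have pi_eq: "pi = pi * (sqrt pi / (Gamma (3/4))\<^sup>2 * (1 / sqrt 2)) / phi_b q" .
  have "y = w" if "pi = pi * w / y" "y > 0" for w y
    using that by (simp add: eq_divide_eq)
  from this[OF pi_eq] have "phi_b q = sqrt pi / (Gamma (3/4))\<^sup>2 * (1 / sqrt 2)"
    using pos by simp
  then show "phi_a q = sqrt pi / (Gamma (3/4))\<^sup>2" unfolding ab by simp
qed

lemma phi_exp_minus_pi: "ramanujan_phi (exp (- pi)) = pi powr (1/4) / Gamma (3/4)"
proof (rule power2_eq_imp_eq)
  have "(pi powr (1/4))\<^sup>2 = sqrt pi"
  proof -
    have "(pi powr (1/4))\<^sup>2 = pi powr (1/4 + 1/4)"
      by (simp only: power2_eq_square powr_add)
    then show ?thesis by (simp add: powr_half_sqrt)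
  qed
  then show "(ramanujan_phi (exp (- pi)))\<^sup>2 = (pi powr (1/4) / Gamma (3/4))\<^sup>2"
    using phi_exp_minus_pi_aux(2) by (simp add: phi_a_def power_divide)
  show "0 \<le> ramanujan_phi (exp (- pi))" using phi_ge_1[of "exp (- pi)"] by simp
  show "0 \<le> pi powr (1/4) / Gamma (3/4::real)" using Gamma_real_pos[of "3/4"] by simp
qed

lemma phi_exp_minus_2pi:
  "ramanujan_phi (exp (- 2 * pi)) = ramanujan_phi (exp (- pi)) * (sqrt (sqrt 2 + 2) / 2)"
proof (rule power2_eq_imp_eq)
  let ?q = "exp (- pi)"
  have q2: "exp (- 2 * pi) = ?q\<^sup>2" by (simp add: power2_eq_square flip: exp_add)
  have "phi_a (?q\<^sup>2) = (phi_a ?q + phi_b ?q) / 2" by (rule phi_agm_step) auto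
  also have "phi_b ?q = phi_a ?q * (sqrt 2 / 2)"
    using phi_exp_minus_pi_aux(1) by simp
  finally have "phi_a (?q\<^sup>2) = phi_a ?q * ((sqrt 2 + 2) / 4)"
    by (simp add: field_simps)
  then show "(ramanujan_phi (exp (- 2 * pi)))\<^sup>2 = (ramanujan_phi ?q * (sqrt (sqrt 2 + 2) / 2))\<^sup>2"
    unfolding q2 by (simp add: phi_a_def power_mult_distrib power_divide)
  show "0 \<le> ramanujan_phi (exp (- 2 * pi))" using phi_ge_1[of "exp (- 2 * pi)"] by simp
  show "0 \<le> ramanujan_phi ?q * (sqrt (sqrt 2 + 2) / 2)" using phi_ge_1[of ?q] by simp
qed

lemma phi_of_real:
  assumes "\<bar>q\<bar> < 1"
  shows "ramanujan_phi (complex_of_real q) = of_real (ramanujan_phi q)"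
  using assms suminf_of_real[OF phi_summable_nat[of q], where 'a = complex]
  by (simp add: ramanujan_phi_eq)

text \<open>
Modulo 3 the dissection is \<open>\<phi>(z q) = \<phi>(q^9) + z w\<close> with \<open>w\<close> independent of \<open>z\<close>. The choice \<open>z = 1\<close>
  identifies \<open>w\<close>, and the product over \<open>z\<close> is a sum of two cubes.
\<close>
lemma phi_cubic:
  fixes q :: real
  assumes q: "0 < q" "q < 1"
  shows "((ramanujan_phi (q ^ 9)) ^ 3 + (ramanujan_phi q - ramanujan_phi (q ^ 9)) ^ 3) * ramanujan_phi (q ^ 9)
    = (ramanujan_phi (q ^ 3)) ^ 4"
proof -
  let ?q = "complex_of_real q"
  let ?A = "theta_part ?q 3"
  have nq: "norm ?q < 1" using q by simp
  have A2: "?A 2 = ?A 1" using theta_part_reflect[of 1 3 ?q] by simp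
  have A0: "?A 0 = ramanujan_phi (?q ^ 9)" using theta_part_0[of 3 ?q] by simp
  have dissect: "ramanujan_phi (z * ?q) = ?A 0 + z * (2 * ?A 1)" if "z \<in> unity_roots 3" for z
  proof -
    have "z ^ 4 = z" using that by (simp add: power_numeral_reduce)
    then show ?thesis
      using phi_dissection[OF nq, of 3 z] that A2 by (simp add: lessThan_nat_numeral algebra_simps)
  qed
  have one: "2 * ?A 1 = ramanujan_phi ?q - ramanujan_phi (?q ^ 9)"
    using dissect[of 1] A0 by simp
  have "(ramanujan_phi (?q ^ 9) ^ 3 + (ramanujan_phi ?q - ramanujan_phi (?q ^ 9)) ^ 3) * ramanujan_phi (?q ^ 9)
     = (\<Prod>z\<in>unity_roots 3. ramanujan_phi (?q ^ 9) + z * (ramanujan_phi ?q - ramanujan_phi (?q ^ 9))) * ramanujan_phi (?q ^ 9)"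
    by (simp add: prod_unity_roots_add)
  also have "\<dots> = (\<Prod>z\<in>unity_roots 3. ramanujan_phi (z * ?q)) * ramanujan_phi (?q ^ 3\<^sup>2)"
    by (intro arg_cong2[where f = "(*)"] prod.cong) (simp_all add: dissect A0 one)
  also have "\<dots> = ramanujan_phi (?q ^ 3) ^ Suc 3"
    by (rule phi_unity_roots) (use nq in auto)
  finally have eq: "(ramanujan_phi (?q ^ 9) ^ 3 + (ramanujan_phi ?q - ramanujan_phi (?q ^ 9)) ^ 3) * ramanujan_phi (?q ^ 9)
      = ramanujan_phi (?q ^ 3) ^ 4" by simp
  have "\<bar>q ^ k\<bar> < 1" if "k > 0" for k
    using q that by (simp add: power_less_one_iff)
  then have "ramanujan_phi ?q = of_real (ramanujan_phi q)" "ramanujan_phi (?q ^ 3) = of_real (ramanujan_phi (q ^ 3))"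
      "ramanujan_phi (?q ^ 9) = of_real (ramanujan_phi (q ^ 9))"
    using phi_of_real[of q] phi_of_real[of "q ^ 3"] phi_of_real[of "q ^ 9"] q by simp_all
  with eq have "complex_of_real (((ramanujan_phi (q ^ 9)) ^ 3 + (ramanujan_phi q - ramanujan_phi (q ^ 9)) ^ 3) * ramanujan_phi (q ^ 9))
      = of_real ((ramanujan_phi (q ^ 3)) ^ 4)"
    by simp
  then show ?thesis by (simp only: of_real_eq_iff)
qed

text \<open>
Since \<open>z^5 = 1\<close>, the factor splits as \<open>(a + z u)(1 - z^4 d)\<close> once \<open>d\<close> solves a quadratic equation,
  and the product of each part is a sum or difference of fifth powers.
\<close>
lemma prod_unity_roots_5:
  fixes B u v :: complex
  assumes "B \<noteq> 0"
  shows "(\<Prod>z\<in>unity_roots 5. B + z * u + z ^ 4 * v)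
    = B ^ 5 + u ^ 5 + v ^ 5 - 5 * B ^ 3 * (u * v) + 5 * B * (u * v)\<^sup>2"
proof -
  \<comment> \<open>Comparing coefficients forces \<open>a = B + u d\<close> and \<open>a d = - v\<close>.\<close>
  obtain d where d: "u * d\<^sup>2 + B * d + v = 0"
  proof (cases "u = 0")
    case True
    then show ?thesis using assms by (intro that[of "- v / B"]) simp
  next
    case False
    define r where "r = csqrt (B\<^sup>2 - 4 * u * v)"
    have r: "r\<^sup>2 = B\<^sup>2 - 4 * u * v" by (simp add: r_def)
    have "4 * u * (u * ((r - B) / (2 * u))\<^sup>2 + B * ((r - B) / (2 * u)) + v) = r\<^sup>2 - (B\<^sup>2 - 4 * u * v)"
      using False by (simp add: field_simps power2_eq_square)
    then show ?thesis using False r by (intro that[of "(r - B) / (2 * u)"]) simp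
  qed
  define a where "a = B + u * d"
  have B: "B = a - u * d" and v: "v = - (a * d)"
    using d by (simp_all add: a_def power2_eq_square algebra_simps eq_neg_iff_add_eq_0)
  have "(\<Prod>z\<in>unity_roots 5. B + z * u + z ^ 4 * v) = (\<Prod>z\<in>unity_roots 5. (a + z * u) * (1 - z ^ 4 * d))"
  proof (intro prod.cong refl)
    fix z assume z: "z \<in> unity_roots 5"
    have "(a + z * u) * (1 - z ^ 4 * d) = a - u * d * z ^ 5 + z * u - z ^ 4 * (a * d)"
      by (simp add: algebra_simps power_numeral_reduce)
    then show "B + z * u + z ^ 4 * v = (a + z * u) * (1 - z ^ 4 * d)"
      using z by (simp add: B v)
  qed
  also have "\<dots> = (a ^ 5 + u ^ 5) * (1 - d ^ 5)"
  proof -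
    have "coprime (4::nat) 5" by (simp add: coprime_iff_gcd_eq_1 gcd_non_0_nat)
    then have bij: "bij_betw (\<lambda>z::complex. z ^ 4) (unity_roots 5) (unity_roots 5)"
      by (intro bij_betw_power_unity_roots) auto
    show ?thesis
      using prod_unity_roots_diff[of 5 1 d] prod.reindex_bij_betw[OF bij, of "\<lambda>w. 1 - w * d"]
      by (simp add: prod.distrib prod_unity_roots_add)
  qed
  also have "\<dots> = B ^ 5 + u ^ 5 + v ^ 5 - 5 * B ^ 3 * (u * v) + 5 * B * (u * v)\<^sup>2"
    unfolding B v by algebra
  finally show ?thesis .
qed

text \<open>
Squares mod 5 are \<open>0, 1, 4\<close>, so the dissection has three parts. The ideal of \<open>2 + i\<close> consists of the pairs
  congruent to multiples of \<open>(2, 1)\<close>, which determines the product of the two nontrivial parts.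
\<close>
lemma theta_parts_5:
  fixes x z :: "'a::{real_normed_field, banach}"
  shows "theta_part x 5 3 = theta_part x 5 2" "theta_part x 5 4 = theta_part x 5 1"
    and "theta_part x 5 0 = ramanujan_phi (x ^ 25)"
    and "norm x < 1 \<Longrightarrow> z ^ 5 = 1 \<Longrightarrow> ramanujan_phi (z * x)
         = ramanujan_phi (x ^ 25) + z * (2 * theta_part x 5 1) + z ^ 4 * (2 * theta_part x 5 2)"
    and "norm x < 1 \<Longrightarrow> 2 * theta_part x 5 1 * (2 * theta_part x 5 2)
         = (ramanujan_phi (x ^ 5))\<^sup>2 - (ramanujan_phi (x ^ 25))\<^sup>2"
proof -
  show refl: "theta_part x 5 3 = theta_part x 5 2" "theta_part x 5 4 = theta_part x 5 1"
    using theta_part_reflect[of 2 5 x] theta_part_reflect[of 1 5 x] by simp_all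
  show zero: "theta_part x 5 0 = ramanujan_phi (x ^ 25)"
    using theta_part_0[of 5 x] by simp
  {
    assume x: "norm x < 1" and z: "z ^ 5 = 1"
    have "z ^ 9 = z ^ 5 * z ^ 4" "z ^ 16 = (z ^ 5) ^ 3 * z"
      by (simp_all flip: power_add power_mult power_Suc2)
    then show "ramanujan_phi (z * x)
       = ramanujan_phi (x ^ 25) + z * (2 * theta_part x 5 1) + z ^ 4 * (2 * theta_part x 5 2)"
      using phi_dissection[OF x, of 5 z] z by (simp add: lessThan_nat_numeral refl zero algebra_simps)
  }
  {
    assume x: "norm x < 1"
    have five: "{0..<int 5} = {0, 1, 2, 3, 4}" by auto
    have "{(r, s). r \<in> {0..<int 5} \<and> s \<in> {0..<int 5} \<and> int 5 dvd 2 * r + 1 * s \<and> int 5 dvd 2 * s - 1 * r}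
        = {(0, 0), (1, 3), (2, 1), (3, 4), (4, 2)}"
      unfolding five by auto
    then show "2 * theta_part x 5 1 * (2 * theta_part x 5 2)
       = (ramanujan_phi (x ^ 5))\<^sup>2 - (ramanujan_phi (x ^ 25))\<^sup>2"
      using phi_square_sublattice[OF x, of 5 2 1] by (simp add: refl zero power2_eq_square)
  }
qed

text \<open>
With \<open>u\<close> and \<open>v\<close> twice the two nontrivial parts mod 5, \<open>s = u + v\<close> and \<open>p = u v\<close>; Newton's identity
  expresses \<open>u^5 + v^5\<close> by them. The inequality holds because \<open>u\<close> and \<open>v\<close> are real, and it selects the
  right root of the equation in \<open>phi_exp_minus_5pi\<close>.
\<close>
lemma phi_quintic:
  fixes q :: real
  assumes q: "0 < q" "q < 1"
  defines "B \<equiv> ramanujan_phi (q ^ 25)"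
  defines "s \<equiv> ramanujan_phi q - B" and "p \<equiv> (ramanujan_phi (q ^ 5))\<^sup>2 - B\<^sup>2"
  shows "(B ^ 5 + (s ^ 5 - 5 * s ^ 3 * p + 5 * s * p\<^sup>2) - 5 * B ^ 3 * p + 5 * B * p\<^sup>2) * B = (ramanujan_phi (q ^ 5)) ^ 6"
    and "4 * p \<le> s\<^sup>2"
proof -
  note dissect = theta_parts_5
  have q': "norm q < 1" using q by simp
  have s_real: "s = 2 * theta_part q 5 1 + 2 * theta_part q 5 2"
    using dissect(4)[of q 1] q by (simp add: s_def B_def)
  have p_real: "p = 2 * theta_part q 5 1 * (2 * theta_part q 5 2)"
    using dissect(5)[OF q'] by (simp add: p_def B_def)
  have "s\<^sup>2 - 4 * p = (2 * theta_part q 5 1 - 2 * theta_part q 5 2)\<^sup>2"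
    unfolding s_real p_real by (simp add: power2_eq_square algebra_simps)
  then show "4 * p \<le> s\<^sup>2" using zero_le_power2 by (metis diff_ge_0_iff_ge)
  let ?q = "complex_of_real q"
  have nq: "norm ?q < 1" using q by simp
  have qk: "\<bar>q ^ k\<bar> < 1" if "k > 0" for k
    using q that by (simp add: power_less_one_iff)
  have phi_c: "ramanujan_phi ?q = of_real (ramanujan_phi q)" "ramanujan_phi (?q ^ 5) = of_real (ramanujan_phi (q ^ 5))"
      "ramanujan_phi (?q ^ 25) = of_real B"
    using phi_of_real[of q] phi_of_real[OF qk, of 5] phi_of_real[OF qk, of 25] q by (simp_all add: B_def)
  define u where "u = 2 * theta_part ?q 5 1"
  define v where "v = 2 * theta_part ?q 5 2"
  have uv: "u + v = of_real s" "u * v = of_real p"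
    using dissect(4)[of ?q 1] dissect(5)[OF nq] nq by (simp_all add: u_def v_def s_def p_def phi_c)
  have "B \<noteq> 0" using phi_ge_1[of "q ^ 25"] qk[of 25] q by (simp add: B_def)
  \<comment> \<open>Over the complex numbers, where the roots of unity live, \<open>u\<close> and \<open>v\<close> have the same sum and product.\<close>
  have newton: "u ^ 5 + v ^ 5 = (u + v) ^ 5 - 5 * (u + v) ^ 3 * (u * v) + 5 * (u + v) * (u * v)\<^sup>2"
    by algebra
  have "(\<Prod>z\<in>unity_roots 5. ramanujan_phi (z * ?q)) = (\<Prod>z\<in>unity_roots 5. of_real B + z * u + z ^ 4 * v)"
    by (intro prod.cong refl) (simp add: dissect(4)[OF nq] u_def v_def phi_c)
  also have "\<dots> = of_real B ^ 5 + (u ^ 5 + v ^ 5) - 5 * of_real B ^ 3 * (u * v) + 5 * of_real B * (u * v)\<^sup>2"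
    using \<open>B \<noteq> 0\<close> by (simp add: prod_unity_roots_5)
  also have "\<dots> = of_real (B ^ 5 + (s ^ 5 - 5 * s ^ 3 * p + 5 * s * p\<^sup>2) - 5 * B ^ 3 * p + 5 * B * p\<^sup>2)"
    unfolding newton uv by simp
  finally have "complex_of_real ((B ^ 5 + (s ^ 5 - 5 * s ^ 3 * p + 5 * s * p\<^sup>2) - 5 * B ^ 3 * p + 5 * B * p\<^sup>2) * B)
     = (\<Prod>z\<in>unity_roots 5. ramanujan_phi (z * ?q)) * ramanujan_phi (?q ^ 5\<^sup>2)"
    by (simp add: phi_c)
  also have "\<dots> = ramanujan_phi (?q ^ 5) ^ Suc 5"
    by (rule phi_unity_roots) (use nq in auto)
  also have "\<dots> = complex_of_real ((ramanujan_phi (q ^ 5)) ^ 6)"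
    by (simp add: phi_c)
  finally show "(B ^ 5 + (s ^ 5 - 5 * s ^ 3 * p + 5 * s * p\<^sup>2) - 5 * B ^ 3 * p + 5 * B * p\<^sup>2) * B = (ramanujan_phi (q ^ 5)) ^ 6"
    by (simp only: of_real_eq_iff)
qed

lemma phi_exp_minus_3pi:
  "ramanujan_phi (exp (- 3 * pi)) = ramanujan_phi (exp (- pi)) * (sqrt (sqrt 3 + 1) / (2 powr (1/4) * 3 powr (3/8)))"
proof (rule power_eq_imp_eq_base[of _ 4])
  define q where "q = exp (- (pi / 3))"
  define B where "B = ramanujan_phi (exp (- 3 * pi))"
  have q: "0 < q" "q < 1" by (simp_all add: q_def)
  have pow: "q ^ 3 = exp (- pi)" "q ^ 9 = exp (- 3 * pi)"
    by (simp_all add: q_def flip: exp_of_nat_mult)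
  have inv: "ramanujan_phi q = sqrt 3 * B"
    using phi_inversion[of 3] by (simp add: q_def B_def mult.commute)
  have "ramanujan_phi (exp (- pi)) ^ 4 = (B ^ 3 + (sqrt 3 * B - B) ^ 3) * B"
    using phi_cubic[OF q] by (simp add: pow inv B_def)
  also have "\<dots> = B ^ 4 * (1 + (sqrt 3 - 1) ^ 3)"
    by (simp add: algebra_simps power_numeral_reduce)
  also have "(sqrt 3 - 1) ^ 3 = 6 * sqrt 3 - (10::real)"
    by (simp add: power3_eq_cube algebra_simps)
  finally have eq: "ramanujan_phi (exp (- pi)) ^ 4 = B ^ 4 * (6 * sqrt 3 - 9)" by simp
  have "(sqrt (sqrt 3 + 1) / (2 powr (1/4) * 3 powr (3/8))) ^ 4 = (2 * sqrt 3 + 3) / 9"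
  proof -
    have "sqrt (sqrt 3 + 1) ^ 4 = (sqrt 3 + 1)\<^sup>2"
      using power_mult[of "sqrt (sqrt 3 + 1)" 2 2] by simp
    moreover have "(2 powr (1/4)) ^ 4 = (2::real)"
      by (simp add: powr_powr flip: powr_realpow)
    moreover have "(3 powr (3/8)) ^ 4 = 3 * sqrt (3::real)"
    proof -
      have "(3 powr (3/8)) ^ 4 = (3::real) powr (1 + 1/2)"
        by (simp add: powr_powr flip: powr_realpow)
      then show ?thesis by (simp only: powr_add powr_half_sqrt) simp
    qed
    ultimately have "(sqrt (sqrt 3 + 1) / (2 powr (1/4) * 3 powr (3/8))) ^ 4 = (sqrt 3 + 1)\<^sup>2 / (2 * (3 * sqrt 3))"
      by (simp add: power_divide power_mult_distrib)
    also have "\<dots> = (2 * sqrt 3 + 3) / 9"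
      by (simp add: field_simps power2_eq_square)
    finally show ?thesis .
  qed
  moreover have "B ^ 4 * (6 * sqrt 3 - 9) * ((2 * sqrt 3 + 3) / 9) = B ^ 4"
  proof -
    have "(6 * sqrt 3 - 9) * (2 * sqrt 3 + 3) = (9::real)" by (simp add: algebra_simps)
    then have "(6 * sqrt 3 - 9) * ((2 * sqrt 3 + 3) / 9) = (1::real)" by simp
    then show ?thesis by (simp only: mult.assoc mult_1_right)
  qed
  ultimately show "(ramanujan_phi (exp (- 3 * pi))) ^ 4
      = (ramanujan_phi (exp (- pi)) * (sqrt (sqrt 3 + 1) / (2 powr (1/4) * 3 powr (3/8)))) ^ 4"
    by (simp only: power_mult_distrib[of "ramanujan_phi (exp (- pi))"] eq flip: B_def)
qed (use phi_ge_1[of "exp (- 3 * pi)"] phi_ge_1[of "exp (- pi)"] in auto)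

lemma phi_exp_minus_5pi:
  "ramanujan_phi (exp (- 5 * pi)) = ramanujan_phi (exp (- pi)) * (sqrt (5 + 2 * sqrt 5) / 5 powr (3/4))"
proof (rule power2_eq_imp_eq)
  define q where "q = exp (- (pi / 5))"
  define B where "B = ramanujan_phi (exp (- 5 * pi))"
  define P where "P = (ramanujan_phi (exp (- pi)))\<^sup>2 / B\<^sup>2 - 1"
  define r where "r = sqrt (5::real)"
  have r: "r\<^sup>2 = 5" "r > 2" by (simp_all add: r_def real_less_rsqrt)
  have q: "0 < q" "q < 1" by (simp_all add: q_def)
  have pow: "q ^ 5 = exp (- pi)" "q ^ 25 = exp (- 5 * pi)"
    by (simp_all add: q_def flip: exp_of_nat_mult)
  have B: "B > 0" using phi_ge_1[of "exp (- 5 * pi)"] by (simp add: B_def)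
  have inv: "ramanujan_phi q = r * B"
    using phi_inversion[of 5] by (simp add: q_def B_def r_def mult.commute)
  have s: "ramanujan_phi q - ramanujan_phi (q ^ 25) = (r - 1) * B"
    unfolding pow inv B_def[symmetric] by (simp add: algebra_simps)
  have phi2: "(ramanujan_phi (exp (- pi)))\<^sup>2 = B\<^sup>2 * (1 + P)"
    using B by (simp add: P_def field_simps)
  have p: "(ramanujan_phi (q ^ 5))\<^sup>2 - (ramanujan_phi (q ^ 25))\<^sup>2 = B\<^sup>2 * P"
    unfolding pow phi2 B_def[symmetric] by (simp add: algebra_simps)
  note quintic = phi_quintic[OF q, unfolded s p, unfolded pow, folded B_def]
  have "B\<^sup>2 * (4 * P) \<le> B\<^sup>2 * (r - 1)\<^sup>2"
    using quintic(2) by (simp add: power_mult_distrib mult_ac)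
  then have "4 * P \<le> (r - 1)\<^sup>2" using B by simp
  moreover have "(r - 1)\<^sup>2 < 16" using r by (simp add: power2_eq_square algebra_simps)
  ultimately have P4: "P < 4" by simp
  have "ramanujan_phi (exp (- pi)) ^ 6 = (B\<^sup>2 * (1 + P)) ^ 3"
    unfolding phi2[symmetric] by (simp flip: power_mult)
  then have "B ^ 6 * (1 + ((r - 1) ^ 5 - 5 * (r - 1) ^ 3 * P + 5 * (r - 1) * P\<^sup>2) - 5 * P + 5 * P\<^sup>2) = B ^ 6 * (1 + P) ^ 3"
    using quintic(1) by algebra
  then have "1 + ((r - 1) ^ 5 - 5 * (r - 1) ^ 3 * P + 5 * (r - 1) * P\<^sup>2) - 5 * P + 5 * P\<^sup>2 = (1 + P) ^ 3"
    using B by simp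
  \<comment> \<open>The cubic equation for \<open>P\<close> has the spurious double root 4.\<close>
  then have "(P - 4)\<^sup>2 * (P - (5 * r - 11)) = 0"
    using r(1) by algebra
  then have "P = 5 * r - 11" using P4 by simp
  then have "(ramanujan_phi (exp (- pi)))\<^sup>2 = B\<^sup>2 * (5 * r - 10)" unfolding phi2 by simp
  moreover have "(sqrt (5 + 2 * r) / 5 powr (3/4))\<^sup>2 = (r + 2) / 5"
  proof -
    have "(5 powr (3/4))\<^sup>2 = (5::real) powr (1 + 1/2)"
      by (simp add: powr_powr flip: powr_realpow)
    also have "\<dots> = 5 * r" by (simp only: powr_add powr_half_sqrt r_def) simp
    finally have "(sqrt (5 + 2 * r) / 5 powr (3/4))\<^sup>2 = (5 + 2 * r) / (5 * r)"
      using r by (simp add: power_divide)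
    also have "\<dots> = (r + 2) / 5" using r by (simp add: field_simps power2_eq_square)
    finally show ?thesis .
  qed
  moreover have "(5 * r - 10) * ((r + 2) / 5) = 1"
  proof -
    have "(5 * r - 10) * (r + 2) = 5" using r(1) by (simp add: algebra_simps power2_eq_square)
    then show ?thesis by simp
  qed
  ultimately show "(ramanujan_phi (exp (- 5 * pi)))\<^sup>2
      = (ramanujan_phi (exp (- pi)) * (sqrt (5 + 2 * sqrt 5) / 5 powr (3/4)))\<^sup>2"
    by (simp only: power_mult_distrib mult.assoc mult_1_right flip: B_def r_def)
qed (use phi_ge_1[of "exp (- 5 * pi)"] phi_ge_1[of "exp (- pi)"] in auto)

section \<open>The integral representation\<close>

text \<open>
The real part of the characteristic function of the standard normal distribution.
\<close>
lemma std_normal_cos: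
  shows "integrable lborel (\<lambda>t::real. exp (- t\<^sup>2 / 2) / sqrt (2 * pi) * cos (s * t))"
    and "(LINT t|lborel. exp (- t\<^sup>2 / 2) / sqrt (2 * pi) * cos (s * t)) = exp (- s\<^sup>2 / 2)"
proof -
  let ?d = "\<lambda>t::real. exp (- t\<^sup>2 / 2) / sqrt (2 * pi)"
  have d: "std_normal_density = ?d" by (simp add: fun_eq_iff std_normal_density_def)
  interpret real_distribution std_normal_distribution by (rule real_dist_normal_dist)
  have "(LINT t|std_normal_distribution. cos (s * t)) = Re (char std_normal_distribution s)"
    unfolding char_def by (subst integral_Re[symmetric]) (auto intro!: integrable_iexp simp: Re_exp)
  also have "\<dots> = exp (- s\<^sup>2 / 2)" by (simp add: char_std_normal_distribution)
  finally have eq: "(LINT t|std_normal_distribution. cos (s * t)) = exp (- s\<^sup>2 / 2)" .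
  have "integrable lborel std_normal_density" by simp
  then have "integrable lborel ?d" unfolding d .
  then show "integrable lborel (\<lambda>t. ?d t * cos (s * t))"
    by (rule Bochner_Integration.integrable_bound) (auto simp: abs_mult intro!: AE_I2 divide_right_mono mult_left_le)
  have "(LINT t|std_normal_distribution. cos (s * t)) = (LINT t|lborel. std_normal_density t * cos (s * t))"
    by (subst integral_density) auto
  then show "(LINT t|lborel. ?d t * cos (s * t)) = exp (- s\<^sup>2 / 2)"
    using eq unfolding d by simp
qed

lemma cos_geometric_sums:
  fixes x \<theta> :: real
  assumes x: "\<bar>x\<bar> < 1"
  shows "(\<lambda>n. x ^ n * cos (real n * \<theta>)) sums ((1 - x * cos \<theta>) / (1 - 2 * x * cos \<theta> + x\<^sup>2))"
proof -
  let ?z = "of_real x * cis \<theta>"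
  have "norm ?z < 1" using x by (simp add: norm_mult)
  then have "(\<lambda>n. Re (?z ^ n)) sums Re (1 / (1 - ?z))"
    by (intro sums_Re geometric_sums)
  moreover have "Re (?z ^ n) = x ^ n * cos (real n * \<theta>)" for n
    by (simp add: power_mult_distrib Complex.DeMoivre flip: of_real_power)
  moreover have "Re (1 / (1 - ?z)) = (1 - x * cos \<theta>) / (1 - 2 * x * cos \<theta> + x\<^sup>2)"
  proof -
    have "(1 - x * cos \<theta>)\<^sup>2 + (x * sin \<theta>)\<^sup>2 = 1 - 2 * x * cos \<theta> + x\<^sup>2"
      by (simp add: power_mult_distrib sin_squared_eq power2_diff algebra_simps)
    then show ?thesis by (simp add: Re_divide)
  qed
  ultimately show ?thesis by simp
qed

definition phi_integrand :: "real \<Rightarrow> real \<Rightarrow> real" where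
  "phi_integrand k t = exp (- t\<^sup>2 / 2) / sqrt (2 * pi) *
     (4 * exp (k * pi) * (exp (2 * k * pi) - cos (sqrt (2 * pi * k) * t)) /
      (exp (4 * k * pi) - 2 * exp (2 * k * pi) * cos (sqrt (2 * pi * k) * t) + 1))"

text \<open>
With \<open>Q = exp (k \<pi>)\<close>, numerator and denominator are divided by powers of \<open>Q^2\<close> to bring the bracket into the
  shape of the geometric cosine series with ratio \<open>1/Q^2\<close>.
\<close>
lemma phi_integrand_sums:
  assumes k: "k > 0"
  shows "(\<lambda>n. 4 * exp (- k * pi) * exp (- 2 * k * pi) ^ n *
            (exp (- t\<^sup>2 / 2) / sqrt (2 * pi) * cos (real n * sqrt (2 * pi * k) * t))) sums phi_integrand k t"
proof -
  let ?d = "exp (- t\<^sup>2 / 2) / sqrt (2 * pi)"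
  define Q where "Q = exp (k * pi)"
  define c where "c = cos (sqrt (2 * pi * k) * t)"
  have Q: "Q > 1" using k by (simp add: Q_def)
  have x: "exp (- 2 * k * pi) = 1 / Q\<^sup>2" "exp (2 * k * pi) = Q\<^sup>2" "exp (4 * k * pi) = (Q\<^sup>2)\<^sup>2" "exp (- k * pi) = 1 / Q"
    by (simp_all add: Q_def exp_minus field_simps flip: exp_of_nat_mult exp_add)
  have lt: "1 / Q\<^sup>2 < 1" using Q by simp
  have "(\<lambda>n. (1 / Q\<^sup>2) ^ n * cos (real n * (sqrt (2 * pi * k) * t))) sums
     ((1 - (1 / Q\<^sup>2) * c) / (1 - 2 * (1 / Q\<^sup>2) * c + (1 / Q\<^sup>2)\<^sup>2))"
    unfolding c_def using lt by (intro cos_geometric_sums) simp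
  then have "(\<lambda>n. 4 * (1 / Q) * ?d * ((1 / Q\<^sup>2) ^ n * cos (real n * (sqrt (2 * pi * k) * t)))) sums
     (4 * (1 / Q) * ?d * ((1 - (1 / Q\<^sup>2) * c) / (1 - 2 * (1 / Q\<^sup>2) * c + (1 / Q\<^sup>2)\<^sup>2)))"
    by (rule sums_mult)
  moreover have "4 * (1 / Q) * ?d * ((1 - (1 / Q\<^sup>2) * c) / (1 - 2 * (1 / Q\<^sup>2) * c + (1 / Q\<^sup>2)\<^sup>2)) = phi_integrand k t"
  proof -
    have "1 - (1 / Q\<^sup>2) * c = (Q\<^sup>2 - c) / Q\<^sup>2" using Q by (simp add: field_simps)
    moreover have "1 - 2 * (1 / Q\<^sup>2) * c + (1 / Q\<^sup>2)\<^sup>2 = ((Q\<^sup>2)\<^sup>2 - 2 * Q\<^sup>2 * c + 1) / (Q\<^sup>2)\<^sup>2"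
      using Q by (simp add: field_simps power2_eq_square)
    ultimately have "(1 - (1 / Q\<^sup>2) * c) / (1 - 2 * (1 / Q\<^sup>2) * c + (1 / Q\<^sup>2)\<^sup>2)
       = Q\<^sup>2 * (Q\<^sup>2 - c) / ((Q\<^sup>2)\<^sup>2 - 2 * Q\<^sup>2 * c + 1)"
      using Q by (simp add: power2_eq_square)
    moreover have "phi_integrand k t = ?d * (4 * Q * (Q\<^sup>2 - c) / ((Q\<^sup>2)\<^sup>2 - 2 * Q\<^sup>2 * c + 1))"
      unfolding phi_integrand_def x c_def[symmetric] Q_def[symmetric] ..
    ultimately show ?thesis using Q by (simp add: power2_eq_square)
  qed
  ultimately show ?thesis unfolding x by (simp add: mult_ac)
qed

text \<open>
The series of the integrand is dominated by a geometric series times the density. The exponents combine to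
  \<open>1 + 2 n + n^2 = (n + 1)^2\<close>.
\<close>
proposition phi_integral_representation:
  assumes k: "k > 0"
  shows "set_integrable lborel {0..} (phi_integrand k)"
    and "ramanujan_phi (exp (- k * pi)) = 1 + (LBINT t:{0..}. phi_integrand k t)"
proof -
  define x where "x = exp (- 2 * k * pi)"
  define a where "a = sqrt (2 * pi * k)"
  define d where "d t = exp (- t\<^sup>2 / 2) / sqrt (2 * pi)" for t :: real
  define g where "g n t = 4 * exp (- k * pi) * x ^ n * (d t * cos (real n * a * t))" for n t
  have x: "0 < x" "x < 1" using k by (simp_all add: x_def)
  have sums: "(\<lambda>n. g n t) sums phi_integrand k t" for t
    using phi_integrand_sums[OF k] by (simp add: g_def x_def a_def d_def)
  have d: "d t \<ge> 0" for t by (simp add: d_def)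
  have d_int: "integrable lborel d"
    using std_normal_cos(1)[of 0] by (simp add: d_def[abs_def])
  have g_int: "integrable lborel (g n)" for n
    unfolding g_def d_def by (intro integrable_mult_right std_normal_cos)
  have g_le: "norm (g n t) \<le> 4 * exp (- k * pi) * x ^ n * d t" for n t
    using x d[of t] abs_cos_le_one[of "real n * a * t"]
    by (simp add: g_def abs_mult mult_left_le)
  have sum_norm: "summable (\<lambda>n. norm (g n t))" for t
  proof (rule summable_comparison_test')
    show "summable (\<lambda>n. 4 * exp (- k * pi) * x ^ n * d t)"
      using x by (intro summable_mult2 summable_mult summable_geometric) simp
  qed (use g_le in simp)
  have sum_int: "summable (\<lambda>n. LINT t|lborel. norm (g n t))"
  proof (rule summable_comparison_test')
    show "summable (\<lambda>n. 4 * exp (- k * pi) * x ^ n * (LINT t|lborel. d t))"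
      using x by (intro summable_mult2 summable_mult summable_geometric) simp
    show "norm (LINT t|lborel. norm (g n t)) \<le> 4 * exp (- k * pi) * x ^ n * (LINT t|lborel. d t)" for n
    proof -
      have "(LINT t|lborel. norm (g n t)) \<le> (LINT t|lborel. 4 * exp (- k * pi) * x ^ n * d t)"
        by (intro integral_mono integrable_norm g_int integrable_mult_right d_int g_le)
      then show ?thesis by simp
    qed
  qed
  have suminf: "(\<lambda>t. \<Sum>n. g n t) = phi_integrand k"
    using sums by (simp add: fun_eq_iff sums_iff)
  have int: "integrable lborel (phi_integrand k)"
    using integrable_suminf[of lborel g] g_int sum_norm sum_int by (simp add: suminf)
  then show "set_integrable lborel {0..} (phi_integrand k)"
    unfolding set_integrable_def by (intro integrable_mult_indicator) auto
  have "(LINT t|lborel. g n t) = 4 * exp (- k * pi) ^ ((Suc n)\<^sup>2)" for n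
  proof -
    have "(LINT t|lborel. g n t) = 4 * exp (- k * pi) * x ^ n * exp (- (real n * a)\<^sup>2 / 2)"
      unfolding g_def d_def by (simp only: integral_mult_right_zero std_normal_cos)
    also have "(real n * a)\<^sup>2 = (real n)\<^sup>2 * (2 * pi * k)"
      using k by (simp add: a_def power_mult_distrib)
    also have "4 * exp (- k * pi) * x ^ n * exp (- ((real n)\<^sup>2 * (2 * pi * k)) / 2)
        = 4 * exp (- k * pi + real n * (- 2 * k * pi) + - ((real n)\<^sup>2 * (2 * pi * k)) / 2)"
      by (simp only: x_def exp_of_nat_mult[symmetric] exp_add mult.assoc)
    also have "- k * pi + real n * (- 2 * k * pi) + - ((real n)\<^sup>2 * (2 * pi * k)) / 2 = real ((Suc n)\<^sup>2) * (- k * pi)"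
      by (simp add: power2_eq_square algebra_simps)
    finally show ?thesis by (simp only: exp_of_nat_mult)
  qed
  then have "(LINT t|lborel. phi_integrand k t) = (\<Sum>n. 4 * exp (- k * pi) ^ ((Suc n)\<^sup>2))"
    using integral_suminf[of lborel g] g_int sum_norm sum_int by (simp add: suminf)
  also have "\<dots> = 4 * (\<Sum>n. exp (- k * pi) ^ ((Suc n)\<^sup>2))"
  proof (rule suminf_mult)
    show "summable (\<lambda>n. exp (- k * pi) ^ ((Suc n)\<^sup>2))"
      using k by (intro phi_summable_nat) simp
  qed
  finally have "(LINT t|lborel. phi_integrand k t) = 4 * (\<Sum>n. exp (- k * pi) ^ ((Suc n)\<^sup>2))" .
  moreover have "(LINT t|lborel. phi_integrand k t) = 2 * (LBINT t:{0..}. phi_integrand k t)"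
    by (rule even_integral_halves(1)[OF int]) (simp add: phi_integrand_def)
  ultimately show "ramanujan_phi (exp (- k * pi)) = 1 + (LBINT t:{0..}. phi_integrand k t)"
    using k by (simp add: ramanujan_phi_eq)
qed

theorem corollary4p7:
  shows "(\<forall>k::real. k > 0 \<longrightarrow>
      (let f = (\<lambda>t::real. exp (- t\<^sup>2 / 2) / sqrt (2 * pi) *
                 (4 * exp (k * pi) * (exp (2 * k * pi) - cos (sqrt (2 * pi * k) * t)) /
                  (exp (4 * k * pi) - 2 * exp (2 * k * pi) * cos (sqrt (2 * pi * k) * t) + 1)))
       in set_integrable lborel {0..} f \<and>
          ramanujan_phi (exp (- k * pi)) = 1 + (LBINT t:{0..}. f t)))
    \<and>
      (let f = (\<lambda>t::real. exp (- t\<^sup>2 / 2) / sqrt (2 * pi) *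
                 (4 * exp pi * (exp (2 * pi) - cos (sqrt (2 * pi) * t)) /
                  (exp (4 * pi) - 2 * exp (2 * pi) * cos (sqrt (2 * pi) * t) + 1)));
           v = pi powr (1/4) / Gamma (3/4)
       in ramanujan_phi (exp (- pi)) = v \<and>
          set_integrable lborel {0..} f \<and> v = 1 + (LBINT t:{0..}. f t))
    \<and>
      (let f = (\<lambda>t::real. exp (- t\<^sup>2 / 2) / sqrt (2 * pi) *
                 (4 * exp (2 * pi) * (exp (4 * pi) - cos (2 * sqrt pi * t)) /
                  (exp (8 * pi) - 2 * exp (4 * pi) * cos (2 * sqrt pi * t) + 1)));
           v = pi powr (1/4) / Gamma (3/4) * (sqrt (sqrt 2 + 2) / 2)
       in ramanujan_phi (exp (- 2 * pi)) = v \<and>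
          set_integrable lborel {0..} f \<and> v = 1 + (LBINT t:{0..}. f t))
    \<and>
      (let f = (\<lambda>t::real. exp (- t\<^sup>2 / 2) / sqrt (2 * pi) *
                 (4 * exp (3 * pi) * (exp (6 * pi) - cos (sqrt (6 * pi) * t)) /
                  (exp (12 * pi) - 2 * exp (6 * pi) * cos (sqrt (6 * pi) * t) + 1)));
           v = pi powr (1/4) / Gamma (3/4) *
                 (sqrt (sqrt 3 + 1) / (2 powr (1/4) * 3 powr (3/8)))
       in ramanujan_phi (exp (- 3 * pi)) = v \<and>
          set_integrable lborel {0..} f \<and> v = 1 + (LBINT t:{0..}. f t))
    \<and>
      (let f = (\<lambda>t::real. exp (- t\<^sup>2 / 2) / sqrt (2 * pi) *
                 (4 * exp (5 * pi) * (exp (10 * pi) - cos (sqrt (10 * pi) * t)) /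
                  (exp (20 * pi) - 2 * exp (10 * pi) * cos (sqrt (10 * pi) * t) + 1)));
           v = pi powr (1/4) / Gamma (3/4) * (sqrt (5 + 2 * sqrt 5) / 5 powr (3/4))
       in ramanujan_phi (exp (- 5 * pi)) = v \<and>
          set_integrable lborel {0..} f \<and> v = 1 + (LBINT t:{0..}. f t))"
proof (intro conjI)
  let ?P = "\<lambda>k v f. ramanujan_phi (exp (- k * pi)) = v \<and>
    set_integrable lborel {0..} f \<and> v = 1 + (LBINT t:{0..}. f t)"
  have special: "?P k v f" if "k > 0" "ramanujan_phi (exp (- k * pi)) = v" "f = phi_integrand k"
    for k v :: real and f :: "real \<Rightarrow> real"
    using phi_integral_representation[OF that(1)] that(2,3) by simp
  show "\<forall>k::real. k > 0 \<longrightarrow>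
      (let f = (\<lambda>t::real. exp (- t\<^sup>2 / 2) / sqrt (2 * pi) *
                 (4 * exp (k * pi) * (exp (2 * k * pi) - cos (sqrt (2 * pi * k) * t)) /
                  (exp (4 * k * pi) - 2 * exp (2 * k * pi) * cos (sqrt (2 * pi * k) * t) + 1)))
       in set_integrable lborel {0..} f \<and>
          ramanujan_phi (exp (- k * pi)) = 1 + (LBINT t:{0..}. f t))"
    unfolding Let_def phi_integrand_def[symmetric] using phi_integral_representation by blast
  show "(let f = (\<lambda>t::real. exp (- t\<^sup>2 / 2) / sqrt (2 * pi) *
                 (4 * exp pi * (exp (2 * pi) - cos (sqrt (2 * pi) * t)) /
                  (exp (4 * pi) - 2 * exp (2 * pi) * cos (sqrt (2 * pi) * t) + 1)));
           v = pi powr (1/4) / Gamma (3/4)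
       in ramanujan_phi (exp (- pi)) = v \<and>
          set_integrable lborel {0..} f \<and> v = 1 + (LBINT t:{0..}. f t))"
    unfolding Let_def
    using special[of 1] phi_exp_minus_pi by (simp add: phi_integrand_def[abs_def])
  show "(let f = (\<lambda>t::real. exp (- t\<^sup>2 / 2) / sqrt (2 * pi) *
                 (4 * exp (2 * pi) * (exp (4 * pi) - cos (2 * sqrt pi * t)) /
                  (exp (8 * pi) - 2 * exp (4 * pi) * cos (2 * sqrt pi * t) + 1)));
           v = pi powr (1/4) / Gamma (3/4) * (sqrt (sqrt 2 + 2) / 2)
       in ramanujan_phi (exp (- 2 * pi)) = v \<and>
          set_integrable lborel {0..} f \<and> v = 1 + (LBINT t:{0..}. f t))"
    unfolding Let_def
  proof (rule special)
    have "sqrt (2 * pi * 2) = 2 * sqrt pi"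
      using real_sqrt_mult[of 4 pi] by (simp add: mult.commute)
    then show "(\<lambda>t. exp (- t\<^sup>2 / 2) / sqrt (2 * pi) * (4 * exp (2 * pi) * (exp (4 * pi) - cos (2 * sqrt pi * t)) /
        (exp (8 * pi) - 2 * exp (4 * pi) * cos (2 * sqrt pi * t) + 1))) = phi_integrand 2"
      by (simp add: phi_integrand_def fun_eq_iff)
  qed (simp, simp only: phi_exp_minus_2pi phi_exp_minus_pi)
  show "(let f = (\<lambda>t::real. exp (- t\<^sup>2 / 2) / sqrt (2 * pi) *
                 (4 * exp (3 * pi) * (exp (6 * pi) - cos (sqrt (6 * pi) * t)) /
                  (exp (12 * pi) - 2 * exp (6 * pi) * cos (sqrt (6 * pi) * t) + 1)));
           v = pi powr (1/4) / Gamma (3/4) *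
                 (sqrt (sqrt 3 + 1) / (2 powr (1/4) * 3 powr (3/8)))
       in ramanujan_phi (exp (- 3 * pi)) = v \<and>
          set_integrable lborel {0..} f \<and> v = 1 + (LBINT t:{0..}. f t))"
    unfolding Let_def
  proof (rule special)
    have "sqrt (2 * pi * 3) = sqrt (6 * pi)"
      by (simp add: mult.commute)
    then show "(\<lambda>t. exp (- t\<^sup>2 / 2) / sqrt (2 * pi) * (4 * exp (3 * pi) * (exp (6 * pi) - cos (sqrt (6 * pi) * t)) /
        (exp (12 * pi) - 2 * exp (6 * pi) * cos (sqrt (6 * pi) * t) + 1))) = phi_integrand 3"
      by (simp add: phi_integrand_def fun_eq_iff)
  qed (simp, simp only: phi_exp_minus_3pi phi_exp_minus_pi)
  show "(let f = (\<lambda>t::real. exp (- t\<^sup>2 / 2) / sqrt (2 * pi) *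
                 (4 * exp (5 * pi) * (exp (10 * pi) - cos (sqrt (10 * pi) * t)) /
                  (exp (20 * pi) - 2 * exp (10 * pi) * cos (sqrt (10 * pi) * t) + 1)));
           v = pi powr (1/4) / Gamma (3/4) * (sqrt (5 + 2 * sqrt 5) / 5 powr (3/4))
       in ramanujan_phi (exp (- 5 * pi)) = v \<and>
          set_integrable lborel {0..} f \<and> v = 1 + (LBINT t:{0..}. f t))"
    unfolding Let_def
  proof (rule special)
    have "sqrt (2 * pi * 5) = sqrt (10 * pi)"
      by (simp add: mult.commute)
    then show "(\<lambda>t. exp (- t\<^sup>2 / 2) / sqrt (2 * pi) * (4 * exp (5 * pi) * (exp (10 * pi) - cos (sqrt (10 * pi) * t)) /
        (exp (20 * pi) - 2 * exp (10 * pi) * cos (sqrt (10 * pi) * t) + 1))) = phi_integrand 5"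
      by (simp add: phi_integrand_def fun_eq_iff)
  qed (simp, simp only: phi_exp_minus_5pi phi_exp_minus_pi)
qed

end
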